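(* Let $\sigma\in W^{1,\infty}(\mathbb{T}^N;\mathbb{R}^{N\times N})$, $A=\sigma\sigma^T$, and let $H\in C(\mathbb{T}^N\times\mathbb{R}^N)$. Assume that there exists $L>1$ such that for all $x,y\in\mathbb{T}^N$ and all $p\in\mathbb{R}^N$ with $|p|=L$, $$H(x,p)\ \ge\ |p|\left[H\Big(y,\frac{p}{|p|}\Big)+|H(\cdot,0)|_\infty+N^{3/2}|\sigma_x|_\infty^2\right].$$ Let $\epsilon>0$, let $\phi^\epsilon\in C(\mathbb{T}^N)$ be a continuous viscosity solution of $$\epsilon\phi^\epsilon-\mathrm{trace}(A(x)D^2\phi^\epsilon)+H(x,D\phi^\epsilon)=0,\qquad x\in\mathbb{T}^N,$$ and let $x_\epsilon\in\mathbb{T}^N$ be such that $\phi^\epsilon(x_\epsilon)=\min_{\mathbb{T}^N}\phi^\epsilon$. Then $$\phi^\epsilon(x)-\phi^\epsilon(x_\epsilon)\le L|x-x_\epsilon|\qquad\text{for all }x\in\mathbb{T}^N,$$ where $L$ is the constant (independent of $\epsilon$) from the assumption above.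
   Context: $\mathbb{T}^N=\mathbb{R}^N/\mathbb{Z}^N$ is the flat torus; functions on $\mathbb{T}^N$ are identified with $\mathbb{Z}^N$-periodic functions on $\mathbb{R}^N$, and for $x,y\in\mathbb{T}^N$, $|x-y|$ is the distance on the torus (minimum of Euclidean distances over representatives). $|H(\cdot,0)|_\infty=\sup_{x}|H(x,0)|$. $|\sigma_x|_\infty$ is the best Lipschitz constant of $x\mapsto\sigma(x)$, matrices being measured in the operator norm. Solutions are in the (Crandall–Lions) viscosity sense. *)

theory Defs
  imports "HOL-Analysis.Analysis"
begin

text \<open>Functions on the flat torus \<open>T\<^sup>N = R\<^sup>N / Z\<^sup>N\<close> are \<open>Z\<^sup>N\<close>-periodic functions on
  \<open>R\<^sup>N\<close>, where \<open>R\<^sup>N\<close> is \<^typ>\<open>real ^ 'n\<close> and \<open>N = CARD('n)\<close>.\<close>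

definition int_lattice :: "(real ^ 'n) set" where
  "int_lattice = {k. \<forall>i. k $ i \<in> \<int>}"

definition torus_periodic :: "(real ^ 'n \<Rightarrow> 'b) \<Rightarrow> bool" where
  "torus_periodic f \<longleftrightarrow> (\<forall>x. \<forall>k\<in>int_lattice. f (x + k) = f x)"

text \<open>The infimum is attained, since \<open>Z\<^sup>N\<close> is closed and discrete.\<close>

definition torus_dist :: "real ^ 'n \<Rightarrow> real ^ 'n \<Rightarrow> real" where
  "torus_dist x y = (INF k\<in>int_lattice. norm (x - y + k))"

text \<open>The library norm on \<^typ>\<open>real ^ 'n ^ 'n\<close> is the Frobenius norm; the Lipschitz constants
  here are taken with respect to the operator norm.\<close>

definition torus_lipschitz :: "real \<Rightarrow> (real ^ 'n \<Rightarrow> real ^ 'n ^ 'n) \<Rightarrow> bool" where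
  "torus_lipschitz C \<sigma> \<longleftrightarrow>
     0 \<le> C \<and> (\<forall>x y. onorm ((*v) (\<sigma> x - \<sigma> y)) \<le> C * torus_dist x y)"

text \<open>\<open>W\<^sup>1\<^sup>,\<^sup>\<infinity>(T\<^sup>N)\<close> is understood as the space of Lipschitz continuous functions on the torus
  (their boundedness is automatic by periodicity).\<close>

definition W1inf_torus :: "(real ^ 'n \<Rightarrow> real ^ 'n ^ 'n) \<Rightarrow> bool" where
  "W1inf_torus \<sigma> \<longleftrightarrow> torus_periodic \<sigma> \<and> (\<exists>C. torus_lipschitz C \<sigma>)"

definition best_lipschitz :: "(real ^ 'n \<Rightarrow> real ^ 'n ^ 'n) \<Rightarrow> real" where
  "best_lipschitz \<sigma> = Inf {C. torus_lipschitz C \<sigma>}"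

text \<open>\<open>C2_function \<psi> D\<psi> D2\<psi>\<close>: \<open>\<psi>\<close> is of class \<open>C\<^sup>2\<close> on \<open>R\<^sup>N\<close> with gradient \<open>D\<psi>\<close> and Hessian
  \<open>D2\<psi>\<close> (both are uniquely determined by \<open>\<psi>\<close>).\<close>

definition C2_function ::
    "(real ^ 'n \<Rightarrow> real) \<Rightarrow> (real ^ 'n \<Rightarrow> real ^ 'n) \<Rightarrow> (real ^ 'n \<Rightarrow> real ^ 'n ^ 'n) \<Rightarrow> bool" where
  "C2_function \<psi> D\<psi> D2\<psi> \<longleftrightarrow>
     (\<forall>x. (\<psi> has_derivative (\<lambda>h. D\<psi> x \<bullet> h)) (at x)) \<and>
     (\<forall>x. (D\<psi> has_derivative (\<lambda>h. D2\<psi> x *v h)) (at x)) \<and>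
     continuous_on UNIV D2\<psi>"

text \<open>Viscosity sub- and supersolutions of \<open>F(x, u, Du, D\<^sup>2u) = 0\<close> for continuous \<open>u\<close>. The test
  functions are \<open>C\<^sup>2\<close> on \<open>R\<^sup>N\<close> and need not be periodic; as the extrema are local, this amounts
  to testing on the torus in local coordinates.\<close>

definition viscosity_subsolution ::
    "(real ^ 'n \<Rightarrow> real \<Rightarrow> real ^ 'n \<Rightarrow> real ^ 'n ^ 'n \<Rightarrow> real) \<Rightarrow> (real ^ 'n \<Rightarrow> real) \<Rightarrow> bool" where
  "viscosity_subsolution F u \<longleftrightarrow>
     (\<forall>\<psi> D\<psi> D2\<psi> x. C2_function \<psi> D\<psi> D2\<psi> \<longrightarrow>
        (\<forall>\<^sub>F y in nhds x. u y - \<psi> y \<le> u x - \<psi> x) \<longrightarrow>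
        F x (u x) (D\<psi> x) (D2\<psi> x) \<le> 0)"

definition viscosity_supersolution ::
    "(real ^ 'n \<Rightarrow> real \<Rightarrow> real ^ 'n \<Rightarrow> real ^ 'n ^ 'n \<Rightarrow> real) \<Rightarrow> (real ^ 'n \<Rightarrow> real) \<Rightarrow> bool" where
  "viscosity_supersolution F u \<longleftrightarrow>
     (\<forall>\<psi> D\<psi> D2\<psi> x. C2_function \<psi> D\<psi> D2\<psi> \<longrightarrow>
        (\<forall>\<^sub>F y in nhds x. u x - \<psi> x \<le> u y - \<psi> y) \<longrightarrow>
        0 \<le> F x (u x) (D\<psi> x) (D2\<psi> x))"

definition viscosity_solution ::
    "(real ^ 'n \<Rightarrow> real \<Rightarrow> real ^ 'n \<Rightarrow> real ^ 'n ^ 'n \<Rightarrow> real) \<Rightarrow> (real ^ 'n \<Rightarrow> real) \<Rightarrow> bool" where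
  "viscosity_solution F u \<longleftrightarrow> viscosity_subsolution F u \<and> viscosity_supersolution F u"

end

theory Submission
  imports Defs
begin

text \<open>
  Write \<open>m = min \<phi>\<close>. It suffices to show \<open>\<phi> x - L \<phi> y + (L - 1) m \<le> L |x - y|\<close> on all of
  \<open>R\<^sup>N \<times> R\<^sup>N\<close>: for \<open>y\<close> a translate of \<open>x\<epsilon>\<close> this is the claim. The factor \<open>L\<close> in front of
  \<open>\<phi> y\<close> is what matches the growth condition: at a positive maximum of the difference of the two sides
  the gradients of the test functions are \<open>p\<close> with \<open>|p| = L\<close> in \<open>x\<close> and \<open>p / |p|\<close> in \<open>y\<close>. Subtracting
  \<open>L\<close> times the supersolution inequality from the subsolution inequality gives
  \<open>\<epsilon> (\<phi> x - L \<phi> y) + H x p - L H y (p / L) \<le> (L / |x - y|) \<Sum>\<^sub>i |\<sigma>\<^sub>i x - \<sigma>\<^sub>i y|\<^sup>2\<close>, where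
  \<open>\<sigma>\<^sub>i\<close> are the columns of \<open>\<sigma>\<close>. The right-hand side is at most \<open>L N |\<sigma>\<^sub>x|\<^sup>2 |x - y|\<close>, and
  \<open>|x - y| \<le> \<surd>N / 2\<close> at a maximum point, since otherwise moving \<open>y\<close> by a lattice vector would
  bring it closer to \<open>x\<close> and increase the difference.
  With \<open>\<epsilon> m \<le> |H(\<cdot>, 0)|\<^sub>\<infinity>\<close>, read off at a maximum point of \<open>\<phi>\<close>, the growth condition is contradicted.

  The work lies in the displayed inequality, as \<open>\<phi>\<close> is only continuous; it is usually deduced from the
  theorem on sums, that is, from Aleksandrov's theorem and Jensen's lemma. Since the second-order
  part is linear, the following elementary route is available (\<open>doubling_inequality\<close>).

  \<^item> Sup-convolution makes \<open>\<phi>\<close> and \<open>- L \<phi>\<close> semiconvex: any \<open>C\<^sup>2\<close> function touching from above has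
    its Hessian bounded below, and its gradient is prescribed by the point where the supremum
    is attained. Near the maximum point one can therefore replace the coefficients \<open>\<sigma>\<close> and the first-order
    terms by constants, at the price of a small multiple of the Laplacian
    (\<open>sup_conv_trace_subsolution\<close>).

  \<^item> A subsolution with constant coefficients grows in the mean along a random walk with the
    corresponding steps. The walk is applied to a smooth periodic approximation, given by the
    Stone--Weierstrass theorem, and compared with the subsolution by touching (\<open>walk_comparison\<close>).

  \<^item> Let the two walks, one for each variable, be driven by the same coin tosses, so that their
    difference moves by \<open>c\<^sub>j - d\<^sub>j\<close>. The cone \<open>L |x - y|\<close> lies below a
    paraboloid \<open>B |x - y|\<^sup>2 + const\<close> that touches it at the maximum point, and the mean of \<open>|x - y|\<^sup>2\<close>
    along the coupled walk is explicit. Growth in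
    the mean of each function and this upper bound give \<open>coupling_inequality\<close>. The steps along the coordinate
    axes that come from the Laplacian are common to both walks and hence cancel.
\<close>

section \<open>Calculus of \<open>C\<^sup>2\<close> functions\<close>

definition outer :: "real ^ 'n \<Rightarrow> real ^ 'n \<Rightarrow> real ^ 'n ^ 'n" where
  "outer a b = (\<chi> i j. a $ i * b $ j)"

abbreviation qform :: "real ^ 'n ^ 'n \<Rightarrow> real ^ 'n \<Rightarrow> real" where
  "qform M v \<equiv> (M *v v) \<bullet> v"

lemma outer_mult_vec: "outer a b *v h = (b \<bullet> h) *\<^sub>R a"
  by (simp add: outer_def vec_eq_iff matrix_vector_mult_def inner_vec_def sum_distrib_left
      sum_distrib_right mult_ac)

lemma scaleR_matrix_mult_vec: "(k *\<^sub>R (A :: real ^ 'n ^ 'm)) *v v = k *\<^sub>R (A *v v)"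
  by (simp add: vec_eq_iff matrix_vector_mult_def sum_distrib_left mult_ac)

lemma norm_matrix_vec_le: "norm ((M :: real ^ 'n ^ 'm) *v v) \<le> norm M * norm v"
proof -
  have "norm (M *v v) = L2_set (\<lambda>i. norm (M $ i \<bullet> v)) UNIV"
    by (simp add: norm_vec_def matrix_vector_mult_def inner_vec_def)
  also have "\<dots> \<le> L2_set (\<lambda>i. norm (M $ i) * norm v) UNIV"
    by (rule L2_set_mono) (auto simp: Cauchy_Schwarz_ineq2)
  also have "\<dots> = norm M * norm v"
    by (simp add: norm_vec_def[of M] L2_set_left_distrib)
  finally show ?thesis .
qed

lemma abs_qform_le: "\<bar>qform M v\<bar> \<le> norm M * (norm v)\<^sup>2"
proof -
  have "\<bar>qform M v\<bar> \<le> norm (M *v v) * norm v" by (rule Cauchy_Schwarz_ineq2)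
  also have "\<dots> \<le> (norm M * norm v) * norm v"
    by (intro mult_right_mono norm_matrix_vec_le) auto
  finally show ?thesis by (simp add: power2_eq_square mult.assoc)
qed

lemma C2_const: "C2_function (\<lambda>_. c) (\<lambda>_. 0) (\<lambda>_. 0)"
proof -
  have 0: "(\<bullet>) (0::real ^ 'n) = (\<lambda>_. 0)" "(*v) (0::real ^ 'n ^ 'n) = (\<lambda>_. 0)"
    by (auto simp: fun_eq_iff)
  show ?thesis
    unfolding C2_function_def 0 by auto
qed

lemma C2_add:
  assumes "C2_function f Df D2f" "C2_function g Dg D2g"
  shows "C2_function (\<lambda>x. f x + g x) (\<lambda>x. Df x + Dg x) (\<lambda>x. D2f x + D2g x)"
  using assms unfolding C2_function_def
  by (auto intro!: continuous_intros derivative_eq_intros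
      simp: inner_add_left matrix_vector_mult_add_rdistrib)

lemma C2_cmult:
  assumes "C2_function f Df D2f"
  shows "C2_function (\<lambda>x. c * f x) (\<lambda>x. c *\<^sub>R Df x) (\<lambda>x. c *\<^sub>R D2f x)"
  using assms unfolding C2_function_def
  by (auto intro!: continuous_intros derivative_eq_intros simp: scaleR_matrix_mult_vec)

lemma C2_derivs:
  assumes "C2_function f Df D2f"
  shows "(f has_derivative (\<lambda>h. Df x \<bullet> h)) (at x)" "(Df has_derivative (\<lambda>h. D2f x *v h)) (at x)"
  using assms by (simp_all add: C2_function_def)

lemma C2_continuous:
  assumes "C2_function f Df D2f"
  shows "continuous_on S f" "continuous_on S Df" "continuous_on S D2f"
proof -
  show "continuous_on S f" "continuous_on S Df"
    by (meson C2_derivs[OF assms] continuous_at_imp_continuous_on has_derivative_continuous)+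
  show "continuous_on S D2f"
    using assms unfolding C2_function_def by (blast intro: continuous_on_subset)
qed

lemma C2_mult:
  assumes f: "C2_function f Df D2f" and g: "C2_function g Dg D2g"
  shows "C2_function (\<lambda>x. f x * g x) (\<lambda>x. f x *\<^sub>R Dg x + g x *\<^sub>R Df x)
    (\<lambda>x. f x *\<^sub>R D2g x + g x *\<^sub>R D2f x + outer (Dg x) (Df x) + outer (Df x) (Dg x))"
  unfolding C2_function_def
proof (intro conjI allI)
  note d = f[unfolded C2_function_def] g[unfolded C2_function_def]
  have d1: "(f has_derivative (\<lambda>h. Df x \<bullet> h)) (at x)"
    "(g has_derivative (\<lambda>h. Dg x \<bullet> h)) (at x)"
    "(Df has_derivative (\<lambda>h. D2f x *v h)) (at x)"
    "(Dg has_derivative (\<lambda>h. D2g x *v h)) (at x)" for x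
    using d by auto
  show "((\<lambda>x. f x * g x) has_derivative (\<lambda>h. (f x *\<^sub>R Dg x + g x *\<^sub>R Df x) \<bullet> h)) (at x)" for x
    by (rule derivative_eq_intros d1 | simp add: algebra_simps)+
  show "((\<lambda>x. f x *\<^sub>R Dg x + g x *\<^sub>R Df x) has_derivative
      (\<lambda>h. (f x *\<^sub>R D2g x + g x *\<^sub>R D2f x + outer (Dg x) (Df x) + outer (Df x) (Dg x)) *v h)) (at x)" for x
    by (rule derivative_eq_intros d1
        | simp add: algebra_simps outer_mult_vec scaleR_matrix_mult_vec)+
  have "continuous_on UNIV (\<lambda>x. outer (Df x) (Dg x))" "continuous_on UNIV (\<lambda>x. outer (Dg x) (Df x))"
    unfolding outer_def
    by (auto intro!: continuous_intros C2_continuous[OF f] C2_continuous[OF g])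
  then show "continuous_on UNIV
      (\<lambda>x. f x *\<^sub>R D2g x + g x *\<^sub>R D2f x + outer (Dg x) (Df x) + outer (Df x) (Dg x))"
    by (intro continuous_intros C2_continuous[OF f] C2_continuous[OF g])
qed

lemma C2_translate:
  fixes f :: "real ^ 'n \<Rightarrow> real"
  assumes "C2_function f Df D2f"
  shows "C2_function (\<lambda>x. f (x + v)) (\<lambda>x. Df (x + v)) (\<lambda>x. D2f (x + v))"
  unfolding C2_function_def
proof (intro conjI allI)
  note d = assms[unfolded C2_function_def]
  have shift: "((\<lambda>x. F (x + v)) has_derivative F') (at x)"
    if "(F has_derivative F') (at (x + v))" for F :: "real ^ 'n \<Rightarrow> 'b::real_normed_vector" and F' x
  proof -
    have "((\<lambda>x. x + v) has_derivative (\<lambda>h. h)) (at x)"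
      by (rule derivative_eq_intros refl | simp)+
    from has_derivative_compose[OF this that] show ?thesis .
  qed
  show "((\<lambda>x. f (x + v)) has_derivative (\<lambda>h. Df (x + v) \<bullet> h)) (at x)"
    "((\<lambda>x. Df (x + v)) has_derivative (\<lambda>h. D2f (x + v) *v h)) (at x)" for x
    using d by (auto intro!: shift)
  show "continuous_on UNIV (\<lambda>x. D2f (x + v))"
    by (rule continuous_on_compose2[OF C2_continuous(3)[OF assms, of UNIV]])
      (auto intro!: continuous_intros)
qed

lemma mat_2_mult_vec: "mat 2 *v v = 2 *\<^sub>R v" for v :: "real ^ 'n"
  by (simp add: vec_eq_iff matrix_vector_mult_def mat_def if_distrib[of "\<lambda>z. z * _"] cong: if_cong)

lemma C2_norm_sq:
  "C2_function (\<lambda>x. (norm (x - a))\<^sup>2) (\<lambda>x. 2 *\<^sub>R (x - a)) (\<lambda>_. mat 2)"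
proof -
  show ?thesis
    unfolding C2_function_def power2_norm_eq_inner
  proof (intro conjI allI)
    show "((\<lambda>x. (x - a) \<bullet> (x - a)) has_derivative (\<lambda>h. (2 *\<^sub>R (x - a)) \<bullet> h)) (at x)" for x
      by (rule derivative_eq_intros refl | simp add: inner_commute)+
    show "((\<lambda>x. 2 *\<^sub>R (x - a)) has_derivative (\<lambda>h. mat 2 *v h)) (at x)" for x
      unfolding mat_2_mult_vec by (rule derivative_eq_intros refl | simp)+
  qed simp
qed

text \<open>Taylor's formula for the even function \<open>t \<mapsto> f (x + t v) + f (x - t v)\<close>, whose derivative vanishes at \<open>0\<close>.\<close>

lemma C2_second_difference:
  assumes "C2_function f Df D2f"
  shows "\<exists>t\<in>{0<..<1}. f (x + v) + f (x - v) - 2 * f x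
           = (qform (D2f (x + t *\<^sub>R v)) v + qform (D2f (x - t *\<^sub>R v)) v) / 2"
proof -
  note d = assms[unfolded C2_function_def]
  define g0 where "g0 t = f (x + t *\<^sub>R v) + f (x + (-t) *\<^sub>R v) - 2 * f x" for t :: real
  define g1 where "g1 t = Df (x + t *\<^sub>R v) \<bullet> v - Df (x + (-t) *\<^sub>R v) \<bullet> v" for t :: real
  define g2 where "g2 t = qform (D2f (x + t *\<^sub>R v)) v + qform (D2f (x + (-t) *\<^sub>R v)) v" for t :: real
  have a: "((\<lambda>t. x + t *\<^sub>R v) has_derivative (\<lambda>s. s *\<^sub>R v)) (at t)"
    "((\<lambda>t. x + (-t) *\<^sub>R v) has_derivative (\<lambda>s. (-s) *\<^sub>R v)) (at t)" for t
    by (auto intro!: derivative_eq_intros)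
  have f1: "(f has_derivative (\<lambda>h. Df y \<bullet> h)) (at y)" "(Df has_derivative (\<lambda>h. D2f y *v h)) (at y)" for y
    using d by auto
  have d0: "(g0 has_real_derivative g1 t) (at t)" for t
    unfolding g0_def g1_def has_field_derivative_def
    by (rule derivative_eq_intros has_derivative_compose[OF a(1) f1(1)] has_derivative_compose[OF a(2) f1(1)]
        refl | simp add: algebra_simps fun_eq_iff)+
  have d1: "(g1 has_real_derivative g2 t) (at t)" for t
    unfolding g1_def g2_def has_field_derivative_def
    by (rule derivative_eq_intros has_derivative_compose[OF a(1) f1(2)] has_derivative_compose[OF a(2) f1(2)]
        refl | simp add: fun_eq_iff matrix_vector_mult_scaleR
          matrix_vector_mult_scaleR[of _ "-1", simplified] algebra_simps)+
  define df where "df m = (if m = 0 then g0 else if m = 1 then g1 else g2)" for m :: nat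
  have "\<exists>t>0. t < 1 \<and> g0 1 = (\<Sum>m<2. df m 0 / fact m * 1 ^ m) + df 2 t / fact 2 * 1 ^ 2"
    by (rule Maclaurin) (auto simp: df_def less_2_cases_iff d0 d1)
  then obtain t where "0 < t" "t < 1" "g0 1 = g2 t / 2"
    by (auto simp: df_def numeral_2_eq_2 g0_def g1_def)
  then show ?thesis
    by (intro bexI[of _ t]) (auto simp: g0_def g2_def)
qed

lemma C2_local_min:
  assumes f: "C2_function f Df D2f" and min: "\<forall>\<^sub>F y in nhds x. f x \<le> f y"
  shows "Df x = 0" "qform (D2f x) v \<ge> 0"
proof -
  obtain e where e: "e > 0" "\<And>y. dist y x < e \<Longrightarrow> f x \<le> f y"
    using min by (auto simp: eventually_nhds_metric)
  have "(\<lambda>h. Df x \<bullet> h) = (\<lambda>h. 0)"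
    by (rule differential_zero_maxmin[of x "ball x e" f])
      (use f e in \<open>auto simp: C2_function_def dist_commute\<close>)
  then show "Df x = 0"
    by (metis inner_eq_zero_iff)
  show "qform (D2f x) v \<ge> 0"
  proof (rule ccontr)
    assume neg: "\<not> qform (D2f x) v \<ge> 0"
    have "continuous_on UNIV (\<lambda>y. qform (D2f y) v)"
      unfolding matrix_vector_mult_def
      by (intro continuous_intros C2_continuous[OF f])
    then have "open {y. qform (D2f y) v < 0}"
      by (rule open_Collect_less) auto
    then obtain d where d: "d > 0" "\<And>y. dist y x < d \<Longrightarrow> qform (D2f y) v < 0"
      using neg unfolding open_dist by (metis mem_Collect_eq not_le)
    define s where "s = min d e / (2 * (norm v + 1))"
    have s: "s > 0"
      unfolding s_def using d e by (intro divide_pos_pos mult_pos_pos add_nonneg_pos) auto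
    have "s * norm v < min d e"
    proof -
      have "s * norm v < s * (2 * (norm v + 1))"
        using s by (intro mult_strict_left_mono) (auto intro: le_less_trans[of _ "1 * norm v"])
      also have "\<dots> = min d e"
        by (simp add: s_def add_nonneg_eq_0_iff)
      finally show ?thesis .
    qed
    then have sv: "s * norm v < d" "s * norm v < e" by auto
    obtain t where t: "0 < t" "t < 1" and eq: "f (x + s *\<^sub>R v) + f (x - s *\<^sub>R v) - 2 * f x
           = (qform (D2f (x + t *\<^sub>R s *\<^sub>R v)) (s *\<^sub>R v) + qform (D2f (x - t *\<^sub>R s *\<^sub>R v)) (s *\<^sub>R v)) / 2"
      using C2_second_difference[OF f, of x "s *\<^sub>R v"] by auto
    have "t * s * norm v < d"
      using mult_right_mono[of t 1 "s * norm v"] t s sv(1) unfolding mult.assoc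
      by (smt (verit) mult_nonneg_nonneg norm_ge_zero)
    then have "qform (D2f (x + t *\<^sub>R s *\<^sub>R v)) v < 0" "qform (D2f (x - t *\<^sub>R s *\<^sub>R v)) v < 0"
      using t s by (auto intro!: d simp: dist_norm)
    then have "f (x + s *\<^sub>R v) + f (x - s *\<^sub>R v) - 2 * f x < 0"
      using s unfolding eq by (simp add: matrix_vector_mult_scaleR mult_pos_neg add_neg_neg)
    moreover have "f x \<le> f (x + s *\<^sub>R v)" "f x \<le> f (x - s *\<^sub>R v)"
      using sv s by (auto intro!: e simp: dist_norm)
    ultimately show False by simp
  qed
qed

section \<open>Smooth approximation on the torus\<close>

lemma int_lattice_zero_neg:
  "0 \<in> int_lattice" "k \<in> int_lattice \<Longrightarrow> - k \<in> int_lattice"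
  by (auto simp: int_lattice_def)

lemma lattice_shift_into_cube: "\<exists>k\<in>int_lattice. (x :: real ^ 'n) + k \<in> cbox 0 1"
proof
  show "(\<chi> i. - of_int \<lfloor>x $ i\<rfloor>) \<in> int_lattice" by (simp add: int_lattice_def)
  show "x + (\<chi> i. - of_int \<lfloor>x $ i\<rfloor>) \<in> cbox 0 1"
    by (auto simp: mem_box_cart) linarith
qed

lemma torus_periodic_bounded:
  fixes f :: "real ^ 'n \<Rightarrow> 'b::real_normed_vector"
  assumes per: "torus_periodic f" and cont: "continuous_on UNIV f"
  obtains M where "M > 0" "\<And>x. norm (f x) \<le> M"
proof -
  have "compact (f ` cbox 0 1)"
    by (intro compact_continuous_image continuous_on_subset[OF cont]) auto
  then obtain M where M: "M > 0" "\<And>y. y \<in> f ` cbox 0 1 \<Longrightarrow> norm y \<le> M"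
    using compact_imp_bounded bounded_pos by metis
  have "norm (f x) \<le> M" for x
    using lattice_shift_into_cube[of x] per M(2) unfolding torus_periodic_def
    by (metis imageI)
  then show ?thesis using M(1) that by blast
qed

lemma torus_periodic_uniformly_continuous:
  fixes f :: "real ^ 'n \<Rightarrow> 'b::metric_space"
  assumes per: "torus_periodic f" and cont: "continuous_on UNIV f"
  shows "uniformly_continuous_on UNIV f"
  unfolding uniformly_continuous_on_def
proof (intro allI impI)
  fix e :: real assume e: "e > 0"
  have "uniformly_continuous_on (cbox (-1) 2) f"
    by (intro compact_uniformly_continuous continuous_on_subset[OF cont]) auto
  then obtain d where d: "d > 0"
    "\<And>x y. x \<in> cbox (-1) 2 \<Longrightarrow> y \<in> cbox (-1) 2 \<Longrightarrow> dist y x < d \<Longrightarrow> dist (f y) (f x) < e"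
    unfolding uniformly_continuous_on_def using e by metis
  have "dist (f y) (f x) < e" if xy: "dist y x < min d 1" for x y
  proof -
    obtain k where k: "k \<in> int_lattice" "x + k \<in> cbox 0 1"
      using lattice_shift_into_cube by blast
    have comp: "\<bar>y $ i - x $ i\<bar> < 1" for i
      using component_le_norm_cart[of "y - x" i] xy by (simp add: dist_norm)
    have "x + k \<in> cbox (-1) 2"
      using k(2) by (auto simp: mem_box_cart) (smt (verit, best))+
    moreover have "-1 \<le> y $ i + k $ i \<and> y $ i + k $ i \<le> 2" for i
    proof -
      have "0 \<le> x $ i + k $ i" "x $ i + k $ i \<le> 1" using k(2) by (auto simp: mem_box_cart)
      then show ?thesis using comp[of i] by linarith
    qed
    then have "y + k \<in> cbox (-1) 2"
      by (auto simp: mem_box_cart)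
    ultimately have "dist (f (y + k)) (f (x + k)) < e"
      using xy by (intro d) auto
    then show ?thesis using per k(1) by (simp add: torus_periodic_def)
  qed
  then show "\<exists>d>0. \<forall>x\<in>UNIV. \<forall>x'\<in>UNIV. dist x' x < d \<longrightarrow> dist (f x') (f x) < e"
    using d(1) by (intro exI[of _ "min d 1"]) auto
qed

text \<open>Periodicity of the Hessian is included for its uniform continuity.\<close>

definition periodic_C2 :: "(real ^ 'n \<Rightarrow> real) \<Rightarrow> bool" where
  "periodic_C2 f \<longleftrightarrow> (\<exists>Df D2f. C2_function f Df D2f \<and>
     torus_periodic f \<and> torus_periodic Df \<and> torus_periodic D2f)"

lemma periodic_C2_const: "periodic_C2 (\<lambda>_. c)"
  unfolding periodic_C2_def using C2_const by (force simp: torus_periodic_def)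

lemma periodic_C2_add: "periodic_C2 f \<Longrightarrow> periodic_C2 g \<Longrightarrow> periodic_C2 (\<lambda>x. f x + g x)"
  unfolding periodic_C2_def
  by (elim exE conjE, intro exI conjI, rule C2_add, assumption+) (auto simp: torus_periodic_def)

lemma periodic_C2_mult: "periodic_C2 f \<Longrightarrow> periodic_C2 g \<Longrightarrow> periodic_C2 (\<lambda>x. f x * g x)"
  unfolding periodic_C2_def
  by (elim exE conjE, intro exI conjI, rule C2_mult, assumption+) (auto simp: torus_periodic_def)

text \<open>Plane waves are the building blocks of the approximation; they are obtained with \<open>f\<close> a sine or a cosine.\<close>

lemma C2_ridge:
  assumes "\<And>t. (f has_real_derivative f' t) (at t)" "\<And>t. (f' has_real_derivative f'' t) (at t)"
    and "continuous_on UNIV f''"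
  shows "C2_function (\<lambda>x. f (w \<bullet> x)) (\<lambda>x. f' (w \<bullet> x) *\<^sub>R w) (\<lambda>x. f'' (w \<bullet> x) *\<^sub>R outer w w)"
  unfolding C2_function_def
proof (intro conjI allI)
  have w: "((\<lambda>x. w \<bullet> x) has_derivative (\<lambda>h. w \<bullet> h)) (at x)" for x
    by (rule derivative_eq_intros refl | simp)+
  note d = assms(1,2)[unfolded has_field_derivative_def]
  show "((\<lambda>x. f (w \<bullet> x)) has_derivative (\<lambda>h. (f' (w \<bullet> x) *\<^sub>R w) \<bullet> h)) (at x)" for x
    using has_derivative_compose[OF w d(1)] by simp
  show "((\<lambda>x. f' (w \<bullet> x) *\<^sub>R w) has_derivative (\<lambda>h. (f'' (w \<bullet> x) *\<^sub>R outer w w) *v h)) (at x)" for x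
    using has_derivative_scaleR_left[OF has_derivative_compose[OF w d(2)], of w]
    by (simp add: scaleR_matrix_mult_vec outer_mult_vec)
  show "continuous_on UNIV (\<lambda>x. f'' (w \<bullet> x) *\<^sub>R outer w w)"
    by (intro continuous_intros continuous_on_compose2[OF assms(3)]) auto
qed

lemma periodic_C2_cos: "periodic_C2 (\<lambda>x :: real ^ 'n. cos (2 * pi * x $ i))"
  and periodic_C2_sin: "periodic_C2 (\<lambda>x :: real ^ 'n. sin (2 * pi * x $ i))"
proof -
  define w :: "real ^ 'n" where "w = axis i (2 * pi)"
  have w: "w \<bullet> x = 2 * pi * x $ i" for x by (simp add: w_def inner_axis')
  have per: "torus_periodic (\<lambda>x. F (cos (2 * pi * x $ i)) (sin (2 * pi * x $ i)))"
    for F :: "real \<Rightarrow> real \<Rightarrow> 'a"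
    unfolding torus_periodic_def
  proof (intro allI ballI)
    fix x k :: "real ^ 'n" assume "k \<in> int_lattice"
    then obtain n where "k $ i = of_int n" by (auto simp: int_lattice_def Ints_def)
    then have "2 * pi * (x + k) $ i = 2 * pi * x $ i + of_int n * (2 * pi)"
      by (simp add: algebra_simps)
    then show "F (cos (2 * pi * (x + k) $ i)) (sin (2 * pi * (x + k) $ i))
        = F (cos (2 * pi * x $ i)) (sin (2 * pi * x $ i))"
      by (metis mult.commute sin_cos_eq_iff)
  qed
  have "C2_function (\<lambda>x. cos (w \<bullet> x)) (\<lambda>x. (- sin (w \<bullet> x)) *\<^sub>R w) (\<lambda>x. (- cos (w \<bullet> x)) *\<^sub>R outer w w)"
    by (rule C2_ridge) (auto intro!: derivative_eq_intros continuous_intros)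
  then show "periodic_C2 (\<lambda>x :: real ^ 'n. cos (2 * pi * x $ i))"
    unfolding periodic_C2_def w
    by (intro exI conjI) (assumption | rule per[of "\<lambda>c s. c"] per[of "\<lambda>c s. (- s) *\<^sub>R w"]
        per[of "\<lambda>c s. (- c) *\<^sub>R outer w w"])+
  have "C2_function (\<lambda>x. sin (w \<bullet> x)) (\<lambda>x. cos (w \<bullet> x) *\<^sub>R w) (\<lambda>x. (- sin (w \<bullet> x)) *\<^sub>R outer w w)"
    by (rule C2_ridge) (auto intro!: derivative_eq_intros continuous_intros)
  then show "periodic_C2 (\<lambda>x :: real ^ 'n. sin (2 * pi * x $ i))"
    unfolding periodic_C2_def w
    by (intro exI conjI) (assumption | rule per[of "\<lambda>c s. s"] per[of "\<lambda>c s. c *\<^sub>R w"]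
        per[of "\<lambda>c s. (- s) *\<^sub>R outer w w"])+
qed

text \<open>The standard embedding of the torus as a product of circles: it turns approximation of periodic
  functions into approximation on a compact set.\<close>

definition torus_embedding :: "real ^ 'n \<Rightarrow> (real ^ 'n) \<times> (real ^ 'n)" where
  "torus_embedding x = (\<chi> i. cos (2 * pi * x $ i), \<chi> i. sin (2 * pi * x $ i))"

lemma torus_embedding_eqD:
  assumes "torus_embedding x = torus_embedding y"
  shows "y - x \<in> int_lattice"
proof -
  have "(y - x) $ i \<in> \<int>" for i
  proof -
    have "cos (2 * pi * x $ i) = cos (2 * pi * y $ i)" "sin (2 * pi * x $ i) = sin (2 * pi * y $ i)"
      using assms by (auto simp: torus_embedding_def vec_eq_iff)
    then obtain n :: int where "2 * pi * y $ i = 2 * pi * x $ i + 2 * pi * n"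
      by (metis sin_cos_eq_iff)
    then have "2 * pi * (y $ i - x $ i) = 2 * pi * n" by (simp add: algebra_simps)
    then show ?thesis by simp
  qed
  then show ?thesis by (simp add: int_lattice_def)
qed

lemma continuous_on_torus_embedding: "continuous_on S torus_embedding"
  unfolding torus_embedding_def by (intro continuous_intros)

lemma torus_embedding_cube: "torus_embedding ` cbox 0 1 = range torus_embedding"
proof -
  have "torus_embedding x \<in> torus_embedding ` cbox 0 1" for x :: "real ^ 'n"
  proof -
    obtain k where k: "k \<in> int_lattice" "x + k \<in> cbox 0 1"
      using lattice_shift_into_cube by blast
    have "torus_periodic (\<lambda>x :: real ^ 'n. cos (2 * pi * x $ i))"
      "torus_periodic (\<lambda>x :: real ^ 'n. sin (2 * pi * x $ i))" for i
      using periodic_C2_cos[of i] periodic_C2_sin[of i] by (auto simp only: periodic_C2_def)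
    then have "torus_embedding (x + k) = torus_embedding x"
      using k(1) by (simp add: torus_embedding_def vec_eq_iff torus_periodic_def del: vector_add_component)
    then show ?thesis using k(2) by (metis imageI)
  qed
  then show ?thesis by auto
qed

text \<open>A continuous periodic function descends to a continuous function on the image of the embedding, because
  the embedding restricted to a closed cube is a quotient map onto its image. There the Stone--Weierstrass
  theorem applies to the functions that become periodic \<open>C\<^sup>2\<close> functions after composition; the
  coordinates, which become sines and cosines, separate points.\<close>

proposition periodic_C2_approximation:
  fixes u :: "real ^ 'n \<Rightarrow> real"
  assumes per: "torus_periodic u" and cont: "continuous_on UNIV u" and e: "e > 0"
  obtains q where "periodic_C2 q" "\<And>x. \<bar>u x - q x\<bar> < e"
proof -
  define K where "K = range (torus_embedding :: real ^ 'n \<Rightarrow> _)"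
  define g where "g z = u (SOME x. torus_embedding x = z)" for z
  have g: "g (torus_embedding x) = u x" for x
  proof -
    have "torus_embedding (SOME x'. torus_embedding x' = torus_embedding x) = torus_embedding x"
      by (rule someI) auto
    from torus_embedding_eqD[OF this] show ?thesis
      using per by (metis add_diff_cancel_left' diff_add_cancel g_def torus_periodic_def add.commute)
  qed
  have cube: "torus_embedding ` cbox 0 (1::real ^ 'n) = K"
    by (simp add: K_def torus_embedding_cube)
  have "continuous_on K g"
  proof -
    have "openin (top_of_set K) (K \<inter> g -` T)" if "open T" for T
    proof -
      have "cbox 0 1 \<inter> torus_embedding -` (K \<inter> g -` T) = cbox 0 1 \<inter> u -` T"
        unfolding K_def by (auto simp: g) (metis g)+
      moreover have "openin (top_of_set (cbox 0 1)) (cbox 0 1 \<inter> u -` T)"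
        using continuous_on_subset[OF cont] that by (metis continuous_openin_preimage_gen subset_UNIV)
      ultimately show ?thesis
        using Abstract_Topology_2.continuous_imp_quotient_map[OF continuous_on_torus_embedding cube
            compact_cbox, of "K \<inter> g -` T"]
        by auto
    qed
    then show ?thesis by (simp add: continuous_on_open_gen continuous_openin_preimage_eq)
  qed
  moreover have "compact K"
    unfolding cube[symmetric] by (intro compact_continuous_image continuous_on_torus_embedding compact_cbox)
  ultimately have "\<exists>p. (continuous_on K p \<and> periodic_C2 (\<lambda>x. p (torus_embedding x))) \<and> (\<forall>z\<in>K. \<bar>g z - p z\<bar> < e)"
  proof (intro Stone_Weierstrass_HOL)
    fix z z' assume "z \<in> K \<and> z' \<in> K \<and> z \<noteq> z'"
    then obtain i where "fst z $ i \<noteq> fst z' $ i \<or> snd z $ i \<noteq> snd z' $ i"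
      by (metis prod_eqI vec_eq_iff)
    moreover have "continuous_on K (\<lambda>z. fst z $ i)" "continuous_on K (\<lambda>z. snd z $ i)"
      by (intro continuous_intros)+
    ultimately show "\<exists>f. (continuous_on K f \<and> periodic_C2 (\<lambda>x. f (torus_embedding x))) \<and> f z \<noteq> f z'"
    proof (elim disjE)
      assume "fst z $ i \<noteq> fst z' $ i" "continuous_on K (\<lambda>z. fst z $ i)"
      then show ?thesis
        by (intro exI[of _ "\<lambda>z. fst z $ i"]) (simp add: torus_embedding_def periodic_C2_cos)
    next
      assume "snd z $ i \<noteq> snd z' $ i" "continuous_on K (\<lambda>z. snd z $ i)"
      then show ?thesis
        by (intro exI[of _ "\<lambda>z. snd z $ i"]) (simp add: torus_embedding_def periodic_C2_sin)
    qed
  qed (use e in \<open>simp_all add: continuous_on_add continuous_on_mult periodic_C2_const periodic_C2_add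
      periodic_C2_mult\<close>)
  then obtain p where "periodic_C2 (\<lambda>x. p (torus_embedding x))" "\<forall>z\<in>K. \<bar>g z - p z\<bar> < e"
    by auto
  then show ?thesis
    by (intro that[of "\<lambda>x. p (torus_embedding x)"]) (auto simp: K_def g)
qed

section \<open>Symmetric random walks\<close>

text \<open>The averaging operator of the random walk that picks an index \<open>j\<close> uniformly and then moves by \<open>\<plusminus> h c\<^sub>j\<close>.\<close>

definition walk :: "('j::finite \<Rightarrow> real ^ 'n) \<Rightarrow> real \<Rightarrow> (real ^ 'n \<Rightarrow> 'b::real_vector) \<Rightarrow> real ^ 'n \<Rightarrow> 'b" where
  "walk c h f x = (1 / (2 * real CARD('j))) *\<^sub>R (\<Sum>j\<in>UNIV. f (x + h *\<^sub>R c j) + f (x - h *\<^sub>R c j))"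

text \<open>The trace of \<open>E M\<close> for the covariance matrix \<open>E = \<Sum>\<^sub>j c\<^sub>j c\<^sub>j\<^sup>T\<close>; the trace of \<open>E\<close> itself is
  \<open>energy c\<close>.\<close>

abbreviation trace_along :: "('j::finite \<Rightarrow> real ^ 'n) \<Rightarrow> real ^ 'n ^ 'n \<Rightarrow> real" where
  "trace_along c M \<equiv> (\<Sum>j\<in>UNIV. qform M (c j))"

abbreviation energy :: "('j::finite \<Rightarrow> real ^ 'n) \<Rightarrow> real" where
  "energy c \<equiv> (\<Sum>j\<in>UNIV. (norm (c j))\<^sup>2)"

lemma walk_const: "walk (c :: 'j::finite \<Rightarrow> _) h (\<lambda>_. z) x = z"
  by (simp add: walk_def scaleR_2[symmetric] sum_constant_scaleR)

lemma walk_diff: "walk c h (\<lambda>y. f y - g y) x = walk c h f x - walk c h g x"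
proof -
  have eq: "f a - g a + (f b - g b) = (f a + f b) - (g a + g b)" for a b by simp
  show ?thesis
    unfolding walk_def scaleR_diff_right[symmetric] eq sum_subtractf by simp
qed

lemma walk_translate: "walk c h f (x + v) = walk c h (\<lambda>y. f (y + v)) x"
  by (simp add: walk_def algebra_simps)

lemma norm_walk_le:
  fixes f :: "real ^ 'n \<Rightarrow> 'b::real_normed_vector" and c :: "'j::finite \<Rightarrow> real ^ 'n"
  assumes "\<And>j. norm (f (x + h *\<^sub>R c j)) \<le> B" "\<And>j. norm (f (x - h *\<^sub>R c j)) \<le> B"
  shows "norm (walk c h f x) \<le> B"
proof -
  have "norm (f (x + h *\<^sub>R c j) + f (x - h *\<^sub>R c j)) \<le> 2 * B" for j
    using norm_triangle_ineq[of "f (x + h *\<^sub>R c j)" "f (x - h *\<^sub>R c j)"] assms(1,2)[of j] by linarith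
  then have "norm (\<Sum>j\<in>UNIV. f (x + h *\<^sub>R c j) + f (x - h *\<^sub>R c j)) \<le> (\<Sum>j\<in>(UNIV::'j set). 2 * B)"
    by (intro sum_norm_le) auto
  then show ?thesis
    by (simp add: walk_def field_simps)
qed

lemma norm_walk_diff_le:
  fixes f :: "real ^ 'n \<Rightarrow> 'b::real_normed_vector" and c :: "'j::finite \<Rightarrow> real ^ 'n"
  assumes "\<And>j. norm (f (x + h *\<^sub>R c j) - z) \<le> B" "\<And>j. norm (f (x - h *\<^sub>R c j) - z) \<le> B"
  shows "norm (walk c h f x - z) \<le> B"
  using norm_walk_le[of "\<lambda>y. f y - z" x h c B] assms walk_diff[of c h f "\<lambda>_. z" x]
  by (simp add: walk_const)

text \<open>Averaging commutes with translations, so the modulus of continuity of a Hessian does not deteriorate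
  along the walk. This is what makes one step size work for all times.\<close>

lemma walk_power_oscillation:
  fixes f :: "real ^ 'n \<Rightarrow> 'b::real_normed_vector" and c :: "'j::finite \<Rightarrow> real ^ 'n"
  assumes "\<And>x. norm (f (x + v) - f x) \<le> B"
  shows "norm ((walk c h ^^ k) f (x + v) - (walk c h ^^ k) f x) \<le> B"
proof (induction k arbitrary: x)
  case (Suc k)
  have "norm (walk c h (\<lambda>y. (walk c h ^^ k) f (y + v) - (walk c h ^^ k) f y) x) \<le> B"
    by (intro norm_walk_le Suc.IH)
  then show ?case by (simp add: walk_diff walk_translate)
qed (simp add: assms)

lemma walk_power_ge:
  fixes f :: "real ^ 'n \<Rightarrow> real" and c :: "'j::finite \<Rightarrow> real ^ 'n"
  assumes "\<And>x. B \<le> f x"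
  shows "B \<le> (walk c h ^^ k) f x"
proof (induction k arbitrary: x)
  case (Suc k)
  define g where "g = (walk c h ^^ k) f"
  have "(\<Sum>j\<in>(UNIV::'j set). 2 * B) \<le> (\<Sum>j\<in>UNIV. g (x + h *\<^sub>R c j) + g (x - h *\<^sub>R c j))"
  proof (rule sum_mono)
    fix j
    have "B \<le> g (x + h *\<^sub>R c j)" "B \<le> g (x - h *\<^sub>R c j)"
      unfolding g_def by (rule Suc.IH)+
    then show "2 * B \<le> g (x + h *\<^sub>R c j) + g (x - h *\<^sub>R c j)" by linarith
  qed
  from divide_right_mono[OF this, of "2 * CARD('j)"] have "B \<le> walk c h g x"
    by (simp add: walk_def)
  then show ?case by (simp add: g_def)
qed (simp add: assms)

lemma C2_sum:
  assumes "finite I" "\<And>i. i \<in> I \<Longrightarrow> C2_function (f i) (Df i) (D2f i)"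
  shows "C2_function (\<lambda>x. \<Sum>i\<in>I. f i x) (\<lambda>x. \<Sum>i\<in>I. Df i x) (\<lambda>x. \<Sum>i\<in>I. D2f i x)"
  using assms
proof (induction I rule: finite_induct)
  case empty
  then show ?case using C2_const[of 0] by simp
next
  case (insert i I)
  then show ?case using C2_add[of "f i" "Df i" "D2f i"] by simp
qed

lemma C2_walk_power:
  fixes c :: "'j::finite \<Rightarrow> real ^ 'n"
  assumes "C2_function f Df D2f"
  shows "C2_function ((walk c h ^^ k) f) ((walk c h ^^ k) Df) ((walk c h ^^ k) D2f)"
proof (induction k)
  case (Suc k)
  let ?f = "(walk c h ^^ k) f" and ?Df = "(walk c h ^^ k) Df" and ?D2f = "(walk c h ^^ k) D2f"
  have "C2_function (\<lambda>x. ?f (x + h *\<^sub>R c j) + ?f (x + - (h *\<^sub>R c j)))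
      (\<lambda>x. ?Df (x + h *\<^sub>R c j) + ?Df (x + - (h *\<^sub>R c j)))
      (\<lambda>x. ?D2f (x + h *\<^sub>R c j) + ?D2f (x + - (h *\<^sub>R c j)))" for j
    by (intro C2_add C2_translate Suc.IH)
  from C2_cmult[OF C2_sum[OF finite_class.finite_UNIV this], of "1 / (2 * real CARD('j))"]
  show ?case
    by (simp add: walk_def[abs_def])
qed (simp add: assms)

text \<open>One step corresponds to the time \<open>h\<^sup>2 / 2m\<close> in the heat equation with generator \<open>trace_along c\<close>, where
  \<open>m\<close> is the number of indices.\<close>

lemma walk_step_ge:
  fixes c :: "'j::finite \<Rightarrow> real ^ 'n"
  assumes f: "C2_function f Df D2f"
    and osc: "\<And>y v. norm v \<le> d \<Longrightarrow> norm (D2f (y + v) - D2f y) \<le> \<kappa>"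
    and h: "0 \<le> h" "\<And>j. h * norm (c j) \<le> d"
  shows "walk c h f x \<ge> f x + h\<^sup>2 / (2 * CARD('j)) * (trace_along c (D2f x) - \<kappa> * energy c)"
proof -
  have "f (x + h *\<^sub>R c j) + f (x - h *\<^sub>R c j) \<ge> 2 * f x + h\<^sup>2 * (qform (D2f x) (c j) - \<kappa> * (norm (c j))\<^sup>2)" for j
  proof -
    obtain t where t: "0 < t" "t < 1" and eq: "f (x + h *\<^sub>R c j) + f (x - h *\<^sub>R c j) - 2 * f x
           = (qform (D2f (x + t *\<^sub>R h *\<^sub>R c j)) (h *\<^sub>R c j) + qform (D2f (x - t *\<^sub>R h *\<^sub>R c j)) (h *\<^sub>R c j)) / 2"
      using C2_second_difference[OF f, of x "h *\<^sub>R c j"] by auto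
    have lower: "qform (D2f (x + v)) (c j) \<ge> qform (D2f x) (c j) - \<kappa> * (norm (c j))\<^sup>2" if "norm v \<le> d" for v
    proof -
      have "\<bar>qform (D2f (x + v) - D2f x) (c j)\<bar> \<le> norm (D2f (x + v) - D2f x) * (norm (c j))\<^sup>2"
        by (rule abs_qform_le)
      also have "\<dots> \<le> \<kappa> * (norm (c j))\<^sup>2"
        using osc[OF that] by (intro mult_right_mono) auto
      finally show ?thesis
        by (simp add: matrix_vector_mult_diff_rdistrib inner_diff_left)
    qed
    have "t * (h * norm (c j)) \<le> 1 * (h * norm (c j))"
      using t h(1) by (intro mult_right_mono) auto
    then have small: "norm (t *\<^sub>R h *\<^sub>R c j) \<le> d" "norm (- (t *\<^sub>R h *\<^sub>R c j)) \<le> d"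
      using t h(1) h(2)[of j] by auto
    have hom: "qform M (h *\<^sub>R c j) = h\<^sup>2 * qform M (c j)" for M
      by (simp add: matrix_vector_mult_scaleR power2_eq_square)
    have "h\<^sup>2 * (qform (D2f x) (c j) - \<kappa> * (norm (c j))\<^sup>2)
        \<le> h\<^sup>2 * ((qform (D2f (x + t *\<^sub>R h *\<^sub>R c j)) (c j) + qform (D2f (x - t *\<^sub>R h *\<^sub>R c j)) (c j)) / 2)"
      using lower[OF small(1)] lower[OF small(2)] by (intro mult_left_mono) auto
    then show ?thesis
      using eq unfolding hom by (simp add: algebra_simps)
  qed
  then have "(\<Sum>j\<in>UNIV. 2 * f x + h\<^sup>2 * (qform (D2f x) (c j) - \<kappa> * (norm (c j))\<^sup>2))
     \<le> (\<Sum>j\<in>UNIV. f (x + h *\<^sub>R c j) + f (x - h *\<^sub>R c j))"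
    by (intro sum_mono) auto
  then have "2 * CARD('j) * f x + h\<^sup>2 * (trace_along c (D2f x) - \<kappa> * energy c)
     \<le> (\<Sum>j\<in>UNIV. f (x + h *\<^sub>R c j) + f (x - h *\<^sub>R c j))"
    by (simp add: sum.distrib sum_distrib_left sum_subtractf right_diff_distrib mult_ac)
  then have "(2 * CARD('j) * f x + h\<^sup>2 * (trace_along c (D2f x) - \<kappa> * energy c)) / (2 * CARD('j))
     \<le> walk c h f x"
    unfolding walk_def by (simp add: divide_right_mono)
  then show ?thesis by (simp add: add_divide_distrib)
qed

lemma trace_along_diff_le:
  fixes c :: "'j::finite \<Rightarrow> real ^ 'n"
  shows "trace_along c M \<le> trace_along c M' + norm (M - M') * energy c"
proof -
  have "qform M (c j) \<le> qform M' (c j) + norm (M - M') * (norm (c j))\<^sup>2" for j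
    using abs_qform_le[of "M - M'" "c j"] by (simp add: matrix_vector_mult_diff_rdistrib inner_diff_left)
  then have "trace_along c M \<le> (\<Sum>j\<in>UNIV. qform M' (c j) + norm (M - M') * (norm (c j))\<^sup>2)"
    by (intro sum_mono)
  then show ?thesis by (simp add: sum.distrib sum_distrib_left)
qed

text \<open>The viscosity inequality \<open>trace (E D\<^sup>2u) \<ge> a\<close> with constant coefficients, required only in the ball of
  radius \<open>r\<close> around \<open>x0\<close>.\<close>

definition trace_subsolution ::
    "('j::finite \<Rightarrow> real ^ 'n) \<Rightarrow> real \<Rightarrow> real ^ 'n \<Rightarrow> real \<Rightarrow> (real ^ 'n \<Rightarrow> real) \<Rightarrow> bool" where
  "trace_subsolution c a x0 r u \<longleftrightarrow> (\<forall>\<psi> D\<psi> D2\<psi> x. C2_function \<psi> D\<psi> D2\<psi> \<longrightarrow> dist x x0 < r \<longrightarrow>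
     (\<forall>\<^sub>F y in nhds x. u y - \<psi> y \<le> u x - \<psi> x) \<longrightarrow> a \<le> trace_along c (D2\<psi> x))"

text \<open>A supersolution of the heat equation that dominates on the boundary of a ball but is only of order
  \<open>t\<^sup>2\<close> at its centre: the quartic \<open>|x - x0|\<^sup>4\<close> has a Hessian of order \<open>|x - x0|\<^sup>2\<close>, which the
  growth of \<open>|x - x0|\<^sup>2 t\<close> compensates, and the Hessian of this term is of order \<open>t\<close> and is compensated
  by the growth of \<open>t\<^sup>2\<close>.\<close>

definition barrier :: "real \<Rightarrow> real \<Rightarrow> real ^ 'n \<Rightarrow> real \<Rightarrow> real ^ 'n \<Rightarrow> real" where
  "barrier K \<tau> x0 t x = K * ((norm (x - x0))\<^sup>2 * (norm (x - x0))\<^sup>2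
      + 12 * \<tau> * t * (norm (x - x0))\<^sup>2 + 24 * \<tau>\<^sup>2 * t\<^sup>2)"

text \<open>The increment over a time \<open>l\<close> is compared with the Hessian at the final time \<open>s + l\<close>, as the
  implicit scheme in the comparison below needs it; the coefficient \<open>24\<close> in the barrier, twice that of the continuous-time
  solution, pays for this.\<close>

lemma barrier_supersolution:
  fixes c :: "'j::finite \<Rightarrow> real ^ 'n"
  assumes "0 \<le> K" "0 \<le> s" "0 \<le> l"
  obtains Db D2b where "C2_function (barrier K (energy c) x0 (s + l)) Db D2b"
    "\<And>x. barrier K (energy c) x0 s x + l * trace_along c (D2b x) \<le> barrier K (energy c) x0 (s + l) x"
proof -
  define \<tau> where "\<tau> = energy c"
  have \<tau>: "\<tau> \<ge> 0" by (simp add: \<tau>_def sum_nonneg)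
  define R where "R x = (norm (x - x0))\<^sup>2" for x
  define DR where "DR x = 2 *\<^sub>R (x - x0)" for x
  have R: "C2_function R DR (\<lambda>_. mat 2)"
    unfolding R_def[abs_def] DR_def[abs_def] by (rule C2_norm_sq)
  define D2b where "D2b x = K *\<^sub>R ((R x *\<^sub>R mat 2 + R x *\<^sub>R mat 2 + outer (DR x) (DR x) + outer (DR x) (DR x))
       + (12 * \<tau> * (s + l)) *\<^sub>R mat 2 + 0)" for x
  have C2: "C2_function (barrier K \<tau> x0 (s + l))
      (\<lambda>x. K *\<^sub>R ((R x *\<^sub>R DR x + R x *\<^sub>R DR x) + (12 * \<tau> * (s + l)) *\<^sub>R DR x + 0)) D2b"
    unfolding barrier_def[abs_def] D2b_def[abs_def] R_def[symmetric]
    by (intro C2_cmult C2_add C2_mult C2_const R)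
  have "trace_along c (D2b x) \<le> K * (12 * \<tau> * R x + 24 * \<tau>\<^sup>2 * (s + l))" for x
  proof -
    have sq: "(DR x \<bullet> v)\<^sup>2 \<le> 4 * R x * (norm v)\<^sup>2" for v
      using Cauchy_Schwarz_ineq[of "DR x" v]
      by (simp add: DR_def R_def power2_norm_eq_inner)
    have qf: "qform (D2b x) v
        = K * ((4 * R x + 24 * \<tau> * (s + l)) * (norm v)\<^sup>2 + 2 * (DR x \<bullet> v)\<^sup>2)" for v
      unfolding D2b_def scaleR_matrix_mult_vec matrix_vector_mult_add_rdistrib outer_mult_vec mat_2_mult_vec
        inner_add_left inner_scaleR_left matrix_vector_mult_0 power2_norm_eq_inner
      by (simp add: power2_eq_square algebra_simps)
    have "(4 * R x + 24 * \<tau> * (s + l)) * (norm v)\<^sup>2 + 2 * (4 * R x * (norm v)\<^sup>2)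
        = (12 * R x + 24 * \<tau> * (s + l)) * (norm v)\<^sup>2" for v :: "real ^ 'n"
      by (simp add: algebra_simps)
    then have "(4 * R x + 24 * \<tau> * (s + l)) * (norm v)\<^sup>2 + 2 * (DR x \<bullet> v)\<^sup>2
        \<le> (12 * R x + 24 * \<tau> * (s + l)) * (norm v)\<^sup>2" for v :: "real ^ 'n"
      using sq[of v] by (smt (verit))
    from mult_left_mono[OF this assms(1)]
    have "qform (D2b x) v \<le> K * ((12 * R x + 24 * \<tau> * (s + l)) * (norm v)\<^sup>2)" for v
      unfolding qf .
    then have "trace_along c (D2b x) \<le> (\<Sum>j\<in>UNIV. K * ((12 * R x + 24 * \<tau> * (s + l)) * (norm (c j))\<^sup>2))"
      by (intro sum_mono)
    also have "\<dots> = K * ((12 * R x + 24 * \<tau> * (s + l)) * \<tau>)"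
      by (simp add: \<tau>_def sum_distrib_left)
    finally show ?thesis by (simp add: algebra_simps power2_eq_square)
  qed
  then have "l * trace_along c (D2b x) \<le> l * (K * (12 * \<tau> * R x + 24 * \<tau>\<^sup>2 * (s + l)))" for x
    using assms(3) by (intro mult_left_mono)
  note 1 = this
  have 2: "barrier K \<tau> x0 (s + l) x - barrier K \<tau> x0 s x
      = l * (K * (12 * \<tau> * R x + 24 * \<tau>\<^sup>2 * (s + l))) + K * (24 * \<tau>\<^sup>2 * s * l)" for x
    by (simp add: barrier_def R_def algebra_simps power2_eq_square)
  have 3: "0 \<le> K * (24 * \<tau>\<^sup>2 * s * l)"
    using assms by simp
  have "barrier K \<tau> x0 s x + l * trace_along c (D2b x) \<le> barrier K \<tau> x0 (s + l) x" for x
    using 1[of x] 2[of x] 3 by linarith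
  then show ?thesis using C2 that unfolding \<tau>_def by blast
qed

text \<open>A discrete maximum principle. At a maximum point of the difference between \<open>u\<close> and the smooth right-hand side at
  time \<open>k + 1\<close>, the latter touches \<open>u\<close> from above, so the trace of its Hessian is at least \<open>a\<close>; since the
  Hessian changes little in one step, the walk must have gained almost \<open>a h\<^sup>2 / 2m\<close> there. On the
  boundary of the ball the barrier excludes a maximum.\<close>

lemma walk_comparison:
  fixes c :: "'j::finite \<Rightarrow> real ^ 'n"
  assumes contu: "continuous_on UNIV u"
    and visc: "trace_subsolution c a x0 r u"
    and q: "C2_function q Dq D2q"
    and osc: "\<And>y v. norm v \<le> d \<Longrightarrow> norm (D2q (y + v) - D2q y) \<le> \<kappa>"
    and h: "0 \<le> h" "\<And>j. h * norm (c j) \<le> d"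
    and bounds: "\<And>x. u x \<le> M" "\<And>x. - M' \<le> q x" "\<And>x. u x \<le> q x + e" "0 \<le> e"
    and K: "0 \<le> K" "0 < r" "M + M' + (\<bar>a\<bar> + 2 * energy c * \<kappa>) * T \<le> K * r ^ 4"
    and time: "real k * (h\<^sup>2 / (2 * CARD('j))) \<le> T" and x: "dist x x0 \<le> r"
  shows "u x \<le> (walk c h ^^ k) q x + barrier K (energy c) x0 (real k * (h\<^sup>2 / (2 * CARD('j)))) x
     - (a - 2 * energy c * \<kappa>) * (real k * (h\<^sup>2 / (2 * CARD('j)))) + e"
proof -
  define l where "l = h\<^sup>2 / (2 * CARD('j))"
  define \<tau> where "\<tau> = energy c"
  have l: "0 \<le> l" by (simp add: l_def)
  have \<tau>: "0 \<le> \<tau>" by (simp add: \<tau>_def sum_nonneg)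
  have "norm (D2q (0 + 0) - D2q 0) \<le> \<kappa>"
    using h(1) h(2)[of undefined] by (intro osc) (smt (verit) mult_nonneg_nonneg norm_ge_zero norm_zero)
  then have \<kappa>: "0 \<le> \<kappa>" by simp
  show ?thesis
    using time x unfolding l_def[symmetric] \<tau>_def[symmetric]
  proof (induction k arbitrary: x)
    case 0
    have "0 \<le> barrier K \<tau> x0 0 x" using K(1) by (simp add: barrier_def)
    then show ?case using bounds(3)[of x] by simp
  next
    case (Suc k)
    define s where "s = real k * l"
    have s: "0 \<le> s" "real (Suc k) * l = s + l" "s + l \<le> T" "s \<le> T"
      using l Suc.prems(1) by (auto simp: s_def algebra_simps)
    obtain Db D2b where b: "C2_function (barrier K \<tau> x0 (s + l)) Db D2b"
      and bstep: "\<And>x. barrier K \<tau> x0 s x + l * trace_along c (D2b x) \<le> barrier K \<tau> x0 (s + l) x"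
      using barrier_supersolution[OF K(1) s(1) l, where c = c and ?x0.0 = x0] unfolding \<tau>_def by blast
    define G where "G = (walk c h ^^ k) q"
    define D2G where "D2G = (walk c h ^^ k) D2q"
    have G: "C2_function G ((walk c h ^^ k) Dq) D2G"
      unfolding G_def D2G_def by (rule C2_walk_power[OF q])
    have G': "C2_function (walk c h G) ((walk c h ^^ Suc k) Dq) (walk c h D2G)"
      using C2_walk_power[OF q, where c = c and h = h and k = "Suc k"] by (simp add: G_def D2G_def)
    have oscG: "norm (D2G (y + v) - D2G y) \<le> \<kappa>" if "norm v \<le> d" for y v
      unfolding D2G_def by (rule walk_power_oscillation) (rule osc[OF that])
    \<comment> \<open>the test function is the right-hand side at the new time, up to an additive constant\<close>
    define \<psi> where "\<psi> y = walk c h G y + barrier K \<tau> x0 (s + l) y" for y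
    define D2\<psi> where "D2\<psi> y = walk c h D2G y + D2b y" for y
    have \<psi>: "C2_function \<psi> (\<lambda>y. (walk c h ^^ Suc k) Dq y + Db y) D2\<psi>"
      unfolding \<psi>_def[abs_def] D2\<psi>_def[abs_def] by (rule C2_add[OF G' b])
    have "continuous_on (cball x0 r) (\<lambda>y. u y - \<psi> y)"
      by (intro continuous_intros continuous_on_subset[OF contu] C2_continuous(1)[OF \<psi>]) auto
    then obtain x1 where "x1 \<in> cball x0 r" "\<forall>y\<in>cball x0 r. u y - \<psi> y \<le> u x1 - \<psi> x1"
      using continuous_attains_sup[OF compact_cball, of x0 r "\<lambda>y. u y - \<psi> y"] K(2) by fastforce
    then have x1: "dist x1 x0 \<le> r" "\<And>y. dist y x0 \<le> r \<Longrightarrow> u y - \<psi> y \<le> u x1 - \<psi> x1"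
      by (simp_all add: dist_commute)
    have "u x1 - \<psi> x1 \<le> e - (a - 2 * \<tau> * \<kappa>) * (s + l)"
    proof (cases "dist x1 x0 < r")
      case False
      have "- M' \<le> (walk c h ^^ Suc k) q x1"
        by (rule walk_power_ge) (rule bounds(2))
      then have 1: "- M' \<le> walk c h G x1" by (simp add: G_def)
      have "norm (x1 - x0) = r" using False x1(1) by (simp add: dist_norm)
      then have "barrier K \<tau> x0 (s + l) x1 = K * r ^ 4 + K * (12 * \<tau> * (s + l) * r\<^sup>2 + 24 * \<tau>\<^sup>2 * (s + l)\<^sup>2)"
        by (simp add: barrier_def power4_eq_xxxx power2_eq_square algebra_simps)
      moreover have "0 \<le> K * (12 * \<tau> * (s + l) * r\<^sup>2 + 24 * \<tau>\<^sup>2 * (s + l)\<^sup>2)"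
        using K(1) \<tau> s(1) l by simp
      ultimately have 2: "K * r ^ 4 \<le> barrier K \<tau> x0 (s + l) x1" by linarith
      have pos: "0 \<le> 2 * \<tau> * \<kappa>" using \<tau> \<kappa> by simp
      have "(a - 2 * \<tau> * \<kappa>) * (s + l) \<le> (\<bar>a\<bar> + 2 * \<tau> * \<kappa>) * (s + l)"
        using s(1) l pos by (intro mult_right_mono) linarith+
      also have "\<dots> \<le> (\<bar>a\<bar> + 2 * \<tau> * \<kappa>) * T"
        using s \<tau> \<kappa> by (intro mult_left_mono) auto
      finally show ?thesis
        using 1 2 bounds(1)[of x1] bounds(4) K(3) unfolding \<psi>_def \<tau>_def[symmetric] by linarith
    next
      case True
      have "\<forall>\<^sub>F y in nhds x1. y \<in> ball x0 r"
        using True by (intro eventually_nhds_in_open) (auto simp: dist_commute)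
      then have "\<forall>\<^sub>F y in nhds x1. u y - \<psi> y \<le> u x1 - \<psi> x1"
        by eventually_elim (auto intro!: x1(2) simp: dist_commute)
      then have "a \<le> trace_along c (D2\<psi> x1)"
        using visc \<psi> True unfolding trace_subsolution_def by blast
      also have "\<dots> = trace_along c (walk c h D2G x1) + trace_along c (D2b x1)"
        by (simp add: D2\<psi>_def matrix_vector_mult_add_rdistrib inner_add_left sum.distrib)
      also have "trace_along c (walk c h D2G x1)
          \<le> trace_along c (D2G x1) + norm (walk c h D2G x1 - D2G x1) * \<tau>"
        unfolding \<tau>_def by (rule trace_along_diff_le)
      also have "norm (walk c h D2G x1 - D2G x1) * \<tau> \<le> \<kappa> * \<tau>"
        using h oscG[of "h *\<^sub>R c _" x1] oscG[of "- h *\<^sub>R c _" x1] \<tau>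
        by (intro mult_right_mono norm_walk_diff_le) auto
      finally have "l * (a - trace_along c (D2b x1) - 2 * \<tau> * \<kappa>) \<le> l * (trace_along c (D2G x1) - \<kappa> * \<tau>)"
        using l by (intro mult_left_mono) (auto simp: algebra_simps)
      moreover have "walk c h G x1 \<ge> G x1 + l * (trace_along c (D2G x1) - \<kappa> * \<tau>)"
        unfolding l_def \<tau>_def using walk_step_ge[OF G oscG h] .
      moreover note bstep[of x1]
      moreover have "u x1 \<le> G x1 + barrier K \<tau> x0 s x1 - (a - 2 * \<tau> * \<kappa>) * s + e"
        using Suc.IH[OF s(4)[unfolded s_def] x1(1)] by (simp add: G_def s_def)
      ultimately show ?thesis
        unfolding \<psi>_def by (simp add: algebra_simps)
    qed
    then have "u x - \<psi> x \<le> e - (a - 2 * \<tau> * \<kappa>) * (s + l)"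
      using x1(2)[OF Suc.prems(2)] by linarith
    then show ?case unfolding s(2) by (simp add: \<psi>_def G_def)
  qed
qed

section \<open>Coupled random walks\<close>

text \<open>Both walks use the same index and the same sign in every step. The difference of their positions is then the
  symmetric walk with steps \<open>c\<^sub>j - d\<^sub>j\<close>, along which the mean of the squared norm grows linearly.\<close>

lemma coupled_walk_le:
  fixes c d :: "'j::finite \<Rightarrow> real ^ 'n" and f g :: "real ^ 'n \<Rightarrow> real"
  assumes "\<And>x y. f x + g y \<le> C + B * (norm (x - y))\<^sup>2"
  shows "(walk c h ^^ k) f x + (walk d h ^^ k) g y
     \<le> C + B * ((norm (x - y))\<^sup>2 + real k * (h\<^sup>2 / CARD('j) * energy (\<lambda>j. c j - d j)))"
proof (induction k arbitrary: x y)
  case (Suc k)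
  define F where "F = (walk c h ^^ k) f"
  define G where "G = (walk d h ^^ k) g"
  define w where "w = h\<^sup>2 / CARD('j) * energy (\<lambda>j. c j - d j)"
  define A where "A = 2 * C + 2 * B * ((norm (x - y))\<^sup>2 + real k * w)"
  have IH: "F x + G y \<le> C + B * ((norm (x - y))\<^sup>2 + real k * w)" for x y
    unfolding F_def G_def w_def by (rule Suc.IH)
  have "(F (x + h *\<^sub>R c j) + F (x - h *\<^sub>R c j)) + (G (y + h *\<^sub>R d j) + G (y - h *\<^sub>R d j))
     \<le> A + 2 * B * h\<^sup>2 * (norm (c j - d j))\<^sup>2" for j
  proof -
    have eq: "(x + h *\<^sub>R c j) - (y + h *\<^sub>R d j) = (x - y) + h *\<^sub>R (c j - d j)"
      "(x - h *\<^sub>R c j) - (y - h *\<^sub>R d j) = (x - y) - h *\<^sub>R (c j - d j)"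
      by (simp_all add: algebra_simps)
    have par: "(norm (a + h *\<^sub>R b))\<^sup>2 + (norm (a - h *\<^sub>R b))\<^sup>2 = 2 * (norm a)\<^sup>2 + 2 * h\<^sup>2 * (norm b)\<^sup>2"
      for a b :: "real ^ 'n"
      unfolding power2_norm_eq_inner
      by (simp add: inner_simps inner_commute[of b a] power2_eq_square algebra_simps)
    have "B * (norm (x - y + h *\<^sub>R (c j - d j)))\<^sup>2 + B * (norm (x - y - h *\<^sub>R (c j - d j)))\<^sup>2
        = B * (2 * (norm (x - y))\<^sup>2 + 2 * h\<^sup>2 * (norm (c j - d j))\<^sup>2)"
      using par[of "x - y" "c j - d j"] by (metis distrib_left)
    then show ?thesis
      using IH[of "x + h *\<^sub>R c j" "y + h *\<^sub>R d j"] IH[of "x - h *\<^sub>R c j" "y - h *\<^sub>R d j"]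
      unfolding eq A_def by (simp add: algebra_simps)
  qed
  then have "(\<Sum>j\<in>UNIV. (F (x + h *\<^sub>R c j) + F (x - h *\<^sub>R c j)) + (G (y + h *\<^sub>R d j) + G (y - h *\<^sub>R d j)))
     \<le> (\<Sum>j\<in>UNIV. A + 2 * B * h\<^sup>2 * (norm (c j - d j))\<^sup>2)"
    by (intro sum_mono)
  also have "\<dots> = CARD('j) * A + 2 * B * h\<^sup>2 * energy (\<lambda>j. c j - d j)"
    by (simp add: sum.distrib sum_distrib_left)
  finally have "(\<Sum>j\<in>UNIV. F (x + h *\<^sub>R c j) + F (x - h *\<^sub>R c j)) + (\<Sum>j\<in>UNIV. G (y + h *\<^sub>R d j) + G (y - h *\<^sub>R d j))
     \<le> CARD('j) * A + 2 * B * h\<^sup>2 * energy (\<lambda>j. c j - d j)"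
    by (simp only: sum.distrib)
  from divide_right_mono[OF this, of "2 * CARD('j)"]
  have "walk c h F x + walk d h G y \<le> (CARD('j) * A + 2 * B * h\<^sup>2 * energy (\<lambda>j. c j - d j)) / (2 * CARD('j))"
    by (simp add: walk_def add_divide_distrib)
  also have "\<dots> = A / 2 + B * w"
    by (simp add: w_def add_divide_distrib)
  also have "\<dots> = C + B * ((norm (x - y))\<^sup>2 + real (Suc k) * w)"
    by (simp add: A_def algebra_simps)
  finally show ?case by (simp add: F_def G_def w_def)
qed (use assms in simp)

text \<open>The mean of a subsolution grows at least at the rate \<open>a\<close>, up to an error quadratic in the time. The
  constant \<open>C\<close> is independent of the smooth approximation \<open>q\<close>, which has to improve as \<open>T\<close> tends to \<open>0\<close>.\<close>

lemma walk_growth: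
  fixes c :: "'j::finite \<Rightarrow> real ^ 'n"
  assumes per: "torus_periodic u" and cont: "continuous_on UNIV u" and r: "0 < r"
    and visc: "trace_subsolution c a x0 r u"
  obtains C where "\<And>T. 0 < T \<Longrightarrow> T \<le> 1 \<Longrightarrow>
      \<exists>q h0. 0 < h0 \<and> (\<forall>x. q x \<le> u x + T\<^sup>2) \<and>
        (\<forall>h k. 0 \<le> h \<longrightarrow> h \<le> h0 \<longrightarrow> real k * (h\<^sup>2 / (2 * CARD('j))) = T \<longrightarrow>
           u x0 \<le> (walk c h ^^ k) q x0 - a * T + C * T\<^sup>2)"
proof -
  obtain M where M: "M > 0" "\<And>x. norm (u x) \<le> M"
    using torus_periodic_bounded[OF per cont] by blast
  define \<tau> where "\<tau> = energy c"
  have \<tau>: "0 \<le> \<tau>" by (simp add: \<tau>_def sum_nonneg)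
  \<comment> \<open>on the boundary of the ball the barrier exceeds the oscillation of u and the drift up to time 1\<close>
  define K where "K = (2 * M + 1 + (\<bar>a\<bar> + 2 * \<tau>)) / r ^ 4"
  have K: "0 \<le> K" using M(1) \<tau> r by (simp add: K_def)
  show ?thesis
  proof (rule that[of "24 * K * \<tau>\<^sup>2 + 2 * \<tau> + 1"])
    fix T :: real assume T: "0 < T" "T \<le> 1"
    have T2: "0 < T\<^sup>2" "T\<^sup>2 \<le> 1" using T by (auto simp: power_le_one)
    obtain q where "periodic_C2 q" and q_close: "\<And>x. \<bar>u x - q x\<bar> < T\<^sup>2"
      using periodic_C2_approximation[OF per cont T2(1)] by blast
    then obtain Dq D2q where q: "C2_function q Dq D2q" and D2q: "torus_periodic D2q"
      by (auto simp: periodic_C2_def)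
    have "uniformly_continuous_on UNIV D2q"
      by (intro torus_periodic_uniformly_continuous D2q C2_continuous[OF q])
    then obtain d0 where d0: "d0 > 0" "\<And>x y. dist y x < d0 \<Longrightarrow> dist (D2q y) (D2q x) < T"
      using T(1) unfolding uniformly_continuous_on_def by (metis UNIV_I)
    define d where "d = d0 / 2"
    have osc: "norm (D2q (y + v) - D2q y) \<le> T" if "norm v \<le> d" for y v
      using d0(2)[of "y + v" y] that d0(1) by (auto simp: d_def dist_norm)
    define D where "D = 1 + (\<Sum>j\<in>UNIV. norm (c j))"
    have D: "D > 0" by (simp add: D_def add_pos_nonneg sum_nonneg)
    have cD: "norm (c j) \<le> D" for j
      using member_le_sum[of j UNIV "\<lambda>j. norm (c j)"] by (simp add: D_def)
    show "\<exists>q h0. 0 < h0 \<and> (\<forall>x. q x \<le> u x + T\<^sup>2) \<and>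
        (\<forall>h k. 0 \<le> h \<longrightarrow> h \<le> h0 \<longrightarrow> real k * (h\<^sup>2 / (2 * CARD('j))) = T \<longrightarrow>
           u x0 \<le> (walk c h ^^ k) q x0 - a * T + (24 * K * \<tau>\<^sup>2 + 2 * \<tau> + 1) * T\<^sup>2)"
    proof (intro exI[of _ q] exI[of _ "d / D"] conjI allI impI)
      show "0 < d / D" using d0(1) D by (simp add: d_def)
      show "q x \<le> u x + T\<^sup>2" for x using q_close[of x] by linarith
      fix h :: real and k :: nat
      assume h: "0 \<le> h" "h \<le> d / D" and kT: "real k * (h\<^sup>2 / (2 * CARD('j))) = T"
      have hc: "h * norm (c j) \<le> d" for j
      proof -
        have "h * norm (c j) \<le> h * D" using cD h(1) by (rule mult_left_mono)
        also have "\<dots> \<le> d / D * D" using h(2) D by (intro mult_right_mono) auto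
        finally show ?thesis using D by simp
      qed
      have bounds: "u x \<le> M" "- (M + 1) \<le> q x" "u x \<le> q x + T\<^sup>2" for x
        using M(2)[of x] q_close[of x] T2 by (auto simp: abs_le_iff abs_less_iff)
      have "2 * \<tau> * T \<le> 2 * \<tau> * 1" using T \<tau> by (intro mult_left_mono) auto
      then have "(\<bar>a\<bar> + 2 * \<tau> * T) * T \<le> (\<bar>a\<bar> + 2 * \<tau>) * 1"
        using T \<tau> by (intro mult_mono) auto
      then have big: "M + (M + 1) + (\<bar>a\<bar> + 2 * energy c * T) * T \<le> K * r ^ 4"
        using r by (simp add: K_def \<tau>_def)
      from walk_comparison[OF cont visc q osc h(1) hc bounds less_imp_le[OF T2(1)] K r big, of k x0]
      show "u x0 \<le> (walk c h ^^ k) q x0 - a * T + (24 * K * \<tau>\<^sup>2 + 2 * \<tau> + 1) * T\<^sup>2"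
        using r unfolding kT \<tau>_def[symmetric] by (simp add: barrier_def algebra_simps power2_eq_square)
    qed
  qed
qed

text \<open>For smooth functions this is the positivity of the Hessian of the right-hand side minus the left-hand side of
  the assumption on the maximum, tested with the vectors \<open>(c\<^sub>j, d\<^sub>j)\<close>. Without second derivatives, the lower bounds for the
  growth of both means are compared with the explicit growth of \<open>|x - y|\<^sup>2\<close> along the coupled
  walk over a short time \<open>T\<close>.\<close>

proposition coupling_inequality:
  fixes c d :: "'j::finite \<Rightarrow> real ^ 'n"
  assumes u1: "torus_periodic u1" "continuous_on UNIV u1"
    and u2: "torus_periodic u2" "continuous_on UNIV u2"
    and max: "\<And>x y. u1 x + u2 y \<le> u1 x0 + u2 y0 + B * ((norm (x - y))\<^sup>2 - (norm (x0 - y0))\<^sup>2)"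
    and r: "0 < r1" "0 < r2"
    and visc1: "trace_subsolution c a1 x0 r1 u1"
    and visc2: "trace_subsolution d a2 y0 r2 u2"
  shows "a1 + a2 \<le> 2 * B * energy (\<lambda>j. c j - d j)"
proof (rule ccontr)
  define S where "S = energy (\<lambda>j. c j - d j)"
  assume "\<not> a1 + a2 \<le> 2 * B * energy (\<lambda>j. c j - d j)"
  then have gap: "0 < a1 + a2 - 2 * B * S" by (simp add: S_def)
  obtain C1 where C1: "\<And>T. 0 < T \<Longrightarrow> T \<le> 1 \<Longrightarrow>
      \<exists>q h0. 0 < h0 \<and> (\<forall>x. q x \<le> u1 x + T\<^sup>2) \<and>
        (\<forall>h k. 0 \<le> h \<longrightarrow> h \<le> h0 \<longrightarrow> real k * (h\<^sup>2 / (2 * CARD('j))) = T \<longrightarrow>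
           u1 x0 \<le> (walk c h ^^ k) q x0 - a1 * T + C1 * T\<^sup>2)"
    using walk_growth[OF u1 r(1) visc1] by blast
  obtain C2 where C2: "\<And>T. 0 < T \<Longrightarrow> T \<le> 1 \<Longrightarrow>
      \<exists>q h0. 0 < h0 \<and> (\<forall>x. q x \<le> u2 x + T\<^sup>2) \<and>
        (\<forall>h k. 0 \<le> h \<longrightarrow> h \<le> h0 \<longrightarrow> real k * (h\<^sup>2 / (2 * CARD('j))) = T \<longrightarrow>
           u2 y0 \<le> (walk d h ^^ k) q y0 - a2 * T + C2 * T\<^sup>2)"
    using walk_growth[OF u2 r(2) visc2] by blast
  define C where "C = \<bar>C1 + C2 + 2\<bar> + 1"
  have C: "C > 0" "C1 + C2 + 2 < C" by (auto simp: C_def)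
  define T where "T = min 1 ((a1 + a2 - 2 * B * S) / C)"
  have T: "0 < T" "T \<le> 1" using gap C by (auto simp: T_def)
  have CT: "C * T \<le> a1 + a2 - 2 * B * S"
    using C(1) by (simp add: T_def min_def field_simps)
  obtain q1 h1 where q1: "0 < h1" "\<And>x. q1 x \<le> u1 x + T\<^sup>2" "\<And>h k. 0 \<le> h \<Longrightarrow> h \<le> h1 \<Longrightarrow>
      real k * (h\<^sup>2 / (2 * CARD('j))) = T \<Longrightarrow> u1 x0 \<le> (walk c h ^^ k) q1 x0 - a1 * T + C1 * T\<^sup>2"
    using C1[OF T] by blast
  obtain q2 h2 where q2: "0 < h2" "\<And>x. q2 x \<le> u2 x + T\<^sup>2" "\<And>h k. 0 \<le> h \<Longrightarrow> h \<le> h2 \<Longrightarrow>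
      real k * (h\<^sup>2 / (2 * CARD('j))) = T \<Longrightarrow> u2 y0 \<le> (walk d h ^^ k) q2 y0 - a2 * T + C2 * T\<^sup>2"
    using C2[OF T] by blast
  define m where "m = min h1 h2"
  have m: "0 < m" using q1(1) q2(1) by (simp add: m_def)
  obtain k :: nat where k: "2 * CARD('j) * T / m\<^sup>2 < real k"
    using reals_Archimedean2 by blast
  have "0 < 2 * CARD('j) * T / m\<^sup>2" using T m by simp
  then have k0: "0 < real k" using k by linarith
  \<comment> \<open>k steps of this size take exactly the time T for both walks\<close>
  define h where "h = sqrt (2 * CARD('j) * T / k)"
  have h: "0 \<le> h" "h\<^sup>2 = 2 * CARD('j) * T / k" using T k0 by (auto simp: h_def)
  have "h\<^sup>2 \<le> m\<^sup>2"
  proof -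
    define A where "A = 2 * CARD('j) * T"
    have "A < real k * m\<^sup>2"
      using k m unfolding A_def[symmetric] by (simp add: pos_divide_less_eq)
    then have "A / real k \<le> m\<^sup>2"
      using k0 by (simp add: pos_divide_le_eq mult.commute)
    then show ?thesis by (simp add: h(2) A_def)
  qed
  then have "h \<le> m" by (rule power2_le_imp_le) (use m in simp)
  then have hm: "h \<le> h1" "h \<le> h2" by (auto simp: m_def)
  have kT: "real k * (h\<^sup>2 / (2 * CARD('j))) = T"
    unfolding h(2) using k0 by simp
  have "q1 x + q2 y \<le> (u1 x0 + u2 y0 + 2 * T\<^sup>2 - B * (norm (x0 - y0))\<^sup>2) + B * (norm (x - y))\<^sup>2" for x y
    using max[of x y] q1(2)[of x] q2(2)[of y] by (simp add: algebra_simps)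
  from coupled_walk_le[of q1 q2, OF this, of k c h x0 d y0]
  have "(walk c h ^^ k) q1 x0 + (walk d h ^^ k) q2 y0
      \<le> u1 x0 + u2 y0 + 2 * T\<^sup>2 + B * (real k * (h\<^sup>2 / CARD('j) * S))"
    by (simp add: S_def algebra_simps)
  also have "real k * (h\<^sup>2 / CARD('j) * S) = 2 * T * S"
    unfolding kT[symmetric] by simp
  finally have "(a1 + a2) * T \<le> 2 * B * S * T + (C1 + C2 + 2) * T\<^sup>2"
    using q1(3)[OF h(1) hm(1) kT] q2(3)[OF h(1) hm(2) kT] by (simp add: algebra_simps)
  then have "(a1 + a2 - 2 * B * S) * T \<le> ((C1 + C2 + 2) * T) * T"
    by (simp add: algebra_simps power2_eq_square)
  then have "a1 + a2 - 2 * B * S \<le> (C1 + C2 + 2) * T"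
    using T(1) by simp
  also have "\<dots> < C * T" using C(2) T(1) by (rule mult_strict_right_mono)
  finally show False using CT by linarith
qed

section \<open>Sup-convolution\<close>

definition sup_conv :: "real \<Rightarrow> (real ^ 'n \<Rightarrow> real) \<Rightarrow> real ^ 'n \<Rightarrow> real" where
  "sup_conv \<delta> \<phi> x = (SUP \<xi>. \<phi> \<xi> - (norm (x - \<xi>))\<^sup>2 / (2 * \<delta>))"

text \<open>The points where the supremum is attained; there may be several.\<close>

definition sup_conv_point :: "real \<Rightarrow> (real ^ 'n \<Rightarrow> real) \<Rightarrow> real ^ 'n \<Rightarrow> real ^ 'n \<Rightarrow> bool" where
  "sup_conv_point \<delta> \<phi> x \<xi> \<longleftrightarrow> sup_conv \<delta> \<phi> x = \<phi> \<xi> - (norm (x - \<xi>))\<^sup>2 / (2 * \<delta>)"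

locale sup_convolution =
  fixes \<phi> :: "real ^ 'n \<Rightarrow> real" and M \<delta> :: real
  assumes cont: "continuous_on UNIV \<phi>" and bound: "\<And>x. \<bar>\<phi> x\<bar> \<le> M" and \<delta>: "0 < \<delta>"
begin

lemma sup_conv_ge: "\<phi> \<xi> - (norm (x - \<xi>))\<^sup>2 / (2 * \<delta>) \<le> sup_conv \<delta> \<phi> x"
  unfolding sup_conv_def
proof (rule cSUP_upper)
  have "\<phi> \<xi> - (norm (x - \<xi>))\<^sup>2 / (2 * \<delta>) \<le> M" for \<xi>
    using bound[of \<xi>] \<delta> by (smt (verit) divide_nonneg_pos zero_le_power2)
  then show "bdd_above (range (\<lambda>\<xi>. \<phi> \<xi> - (norm (x - \<xi>))\<^sup>2 / (2 * \<delta>)))"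
    by (intro bdd_aboveI2)
qed simp

lemma sup_conv_attained: obtains \<xi> where "sup_conv_point \<delta> \<phi> x \<xi>"
proof -
  have M: "0 \<le> M" using bound[of 0] by linarith
  define R where "R = sqrt (4 * M * \<delta>)"
  have R: "0 \<le> R" "R\<^sup>2 = 4 * M * \<delta>" using M \<delta> by (auto simp: R_def)
  define f where "f \<xi> = \<phi> \<xi> - (norm (x - \<xi>))\<^sup>2 / (2 * \<delta>)" for \<xi>
  have "continuous_on (cball x R) f"
    unfolding f_def by (intro continuous_intros continuous_on_subset[OF cont]) (use \<delta> in auto)
  then obtain \<xi> where \<xi>: "\<xi> \<in> cball x R" "\<forall>y\<in>cball x R. f y \<le> f \<xi>"
    using continuous_attains_sup[OF compact_cball, of x R f] R(1) by fastforce
  have le: "f y \<le> f \<xi>" for y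
  proof (cases "y \<in> cball x R")
    case False
    then have "R\<^sup>2 \<le> (norm (x - y))\<^sup>2"
      using R(1) by (intro power_mono) (auto simp: dist_norm)
    then have "R\<^sup>2 / (2 * \<delta>) \<le> (norm (x - y))\<^sup>2 / (2 * \<delta>)"
      using \<delta> by (intro divide_right_mono) auto
    moreover have "R\<^sup>2 / (2 * \<delta>) = 2 * M" unfolding R(2) using \<delta> by simp
    ultimately have "f y \<le> \<phi> x" using bound[of y] bound[of x] unfolding f_def by linarith
    also have "\<dots> = f x" by (simp add: f_def)
    also have "\<dots> \<le> f \<xi>" using \<xi>(2) R(1) by simp
    finally show ?thesis .
  qed (use \<xi> in auto)
  have "sup_conv \<delta> \<phi> x = f \<xi>"
    unfolding sup_conv_def f_def[symmetric]
    by (intro cSup_eq_maximum) (use le in auto)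
  then show ?thesis using that by (simp add: sup_conv_point_def f_def)
qed

text \<open>Moving away from \<open>x\<close> costs more than the oscillation of \<open>\<phi>\<close> can return.\<close>

lemma sup_conv_point_dist:
  assumes "sup_conv_point \<delta> \<phi> x \<xi>"
  shows "(norm (x - \<xi>))\<^sup>2 \<le> 4 * M * \<delta>"
proof -
  have "(norm (x - \<xi>))\<^sup>2 / (2 * \<delta>) \<le> 2 * M"
    using sup_conv_ge[of x x] assms bound[of x] bound[of \<xi>] by (simp add: sup_conv_point_def)
  then show ?thesis using \<delta> by (simp add: field_simps)
qed

text \<open>Semiconvexity: keep \<open>\<xi>\<close> fixed and expand the square.\<close>

lemma sup_conv_supporting_paraboloid:
  assumes "sup_conv_point \<delta> \<phi> x \<xi>"
  shows "sup_conv \<delta> \<phi> (x + f) \<ge> sup_conv \<delta> \<phi> x + ((1 / \<delta>) *\<^sub>R (\<xi> - x)) \<bullet> f - (norm f)\<^sup>2 / (2 * \<delta>)"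
proof -
  have "(norm (x + f - \<xi>))\<^sup>2 = (norm (x - \<xi>))\<^sup>2 - 2 * ((\<xi> - x) \<bullet> f) + (norm f)\<^sup>2"
    by (simp add: power2_norm_eq_inner inner_simps inner_commute algebra_simps)
  then have "(norm (x + f - \<xi>))\<^sup>2 / (2 * \<delta>)
      = (norm (x - \<xi>))\<^sup>2 / (2 * \<delta>) - (1 / \<delta>) * ((\<xi> - x) \<bullet> f) + (norm f)\<^sup>2 / (2 * \<delta>)"
    using \<delta> by (simp add: field_simps)
  then show ?thesis
    using sup_conv_ge[of \<xi> "x + f"] assms unfolding sup_conv_point_def inner_scaleR_left by linarith
qed

lemma sup_conv_continuous: "continuous_on UNIV (sup_conv \<delta> \<phi>)"
proof -
  define R where "R = sqrt (4 * M * \<delta>)"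
  have drop: "sup_conv \<delta> \<phi> x - sup_conv \<delta> \<phi> y \<le> (1 / \<delta>) * R * dist y x + (dist y x)\<^sup>2 / (2 * \<delta>)" for x y
  proof -
    obtain \<xi> where \<xi>: "sup_conv_point \<delta> \<phi> x \<xi>" using sup_conv_attained .
    have "norm (\<xi> - x) \<le> R"
      using real_sqrt_le_mono[OF sup_conv_point_dist[OF \<xi>]] by (simp add: R_def norm_minus_commute)
    then have "- ((\<xi> - x) \<bullet> (y - x)) \<le> R * dist y x"
      using Cauchy_Schwarz_ineq2[of "\<xi> - x" "y - x"] mult_right_mono[of "norm (\<xi> - x)" R "norm (y - x)"]
      by (simp add: dist_norm)
    then have "(1 / \<delta>) * (- ((\<xi> - x) \<bullet> (y - x))) \<le> (1 / \<delta>) * (R * dist y x)"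
      using \<delta> by (intro mult_left_mono) auto
    then show ?thesis
      using sup_conv_supporting_paraboloid[OF \<xi>, of "y - x"] by (simp add: dist_norm algebra_simps)
  qed
  have "isCont (sup_conv \<delta> \<phi>) x" for x
    unfolding isCont_def
  proof (rule LIM_zero_cancel, rule Lim_null_comparison)
    show "\<forall>\<^sub>F y in at x. norm (sup_conv \<delta> \<phi> y - sup_conv \<delta> \<phi> x)
        \<le> (1 / \<delta>) * R * dist y x + (dist y x)\<^sup>2 / (2 * \<delta>)"
    proof (intro always_eventually allI)
      fix y
      show "norm (sup_conv \<delta> \<phi> y - sup_conv \<delta> \<phi> x) \<le> (1 / \<delta>) * R * dist y x + (dist y x)\<^sup>2 / (2 * \<delta>)"
        using drop[of x y] drop[of y x] unfolding dist_commute[of x y] real_norm_def by linarith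
    qed
    have "isCont (\<lambda>y. (1 / \<delta>) * R * dist y x + (dist y x)\<^sup>2 / (2 * \<delta>)) x"
      by (intro continuous_intros) (use \<delta> in simp)
    then show "((\<lambda>y. (1 / \<delta>) * R * dist y x + (dist y x)\<^sup>2 / (2 * \<delta>)) \<longlongrightarrow> 0) (at x)"
      by (simp add: isCont_def)
  qed
  then show ?thesis by (simp add: continuous_at_imp_continuous_on)
qed

lemma sup_conv_periodic:
  assumes "torus_periodic \<phi>"
  shows "torus_periodic (sup_conv \<delta> \<phi>)"
proof -
  have le: "sup_conv \<delta> \<phi> x \<le> sup_conv \<delta> \<phi> (x + k)" if "k \<in> int_lattice" for x k
  proof -
    obtain \<xi> where "sup_conv_point \<delta> \<phi> x \<xi>" using sup_conv_attained .
    then show ?thesis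
      using sup_conv_ge[of "\<xi> + k" "x + k"] assms that
      by (simp add: sup_conv_point_def torus_periodic_def)
  qed
  show ?thesis
    unfolding torus_periodic_def
  proof (intro allI ballI antisym)
    fix x k :: "real ^ 'n" assume k: "k \<in> int_lattice"
    show "sup_conv \<delta> \<phi> x \<le> sup_conv \<delta> \<phi> (x + k)" by (rule le[OF k])
    show "sup_conv \<delta> \<phi> (x + k) \<le> sup_conv \<delta> \<phi> x"
      using le[of "- k" "x + k"] int_lattice_zero_neg(2)[OF k] by simp
  qed
qed

text \<open>A function touching the sup-convolution at \<open>x\<close> from above touches \<open>\<phi>\<close> at \<open>\<xi>\<close> after a translation, so the
  viscosity inequality for \<open>\<phi>\<close> can be used. On the other side it is touched by the supporting
  paraboloid, which fixes its gradient and bounds its Hessian from below.\<close>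

lemma sup_conv_touching:
  assumes \<psi>: "C2_function \<psi> D\<psi> D2\<psi>" and \<xi>: "sup_conv_point \<delta> \<phi> x \<xi>"
    and touch: "\<forall>\<^sub>F y in nhds x. sup_conv \<delta> \<phi> y - \<psi> y \<le> sup_conv \<delta> \<phi> x - \<psi> x"
  shows "\<forall>\<^sub>F y in nhds \<xi>. \<phi> y - \<psi> (y + (x - \<xi>)) \<le> \<phi> \<xi> - \<psi> (\<xi> + (x - \<xi>))"
    and "D\<psi> x = (1 / \<delta>) *\<^sub>R (\<xi> - x)"
    and "0 \<le> qform (D2\<psi> x) v + (norm v)\<^sup>2 / \<delta>"
proof -
  obtain e where e: "e > 0" "\<And>y. dist y x < e \<Longrightarrow> sup_conv \<delta> \<phi> y - \<psi> y \<le> sup_conv \<delta> \<phi> x - \<psi> x"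
    using touch by (auto simp: eventually_nhds_metric)
  have "\<phi> y - \<psi> (y + (x - \<xi>)) \<le> \<phi> \<xi> - \<psi> (\<xi> + (x - \<xi>))" if "dist y \<xi> < e" for y
    using e(2)[of "y + (x - \<xi>)"] that sup_conv_ge[of y "y + (x - \<xi>)"] \<xi>
    by (simp add: dist_norm sup_conv_point_def)
  then show "\<forall>\<^sub>F y in nhds \<xi>. \<phi> y - \<psi> (y + (x - \<xi>)) \<le> \<phi> \<xi> - \<psi> (\<xi> + (x - \<xi>))"
    using e(1) by (auto simp: eventually_nhds_metric)
  define f where "f y = \<psi> y + (1 / (2 * \<delta>)) * (norm (y - \<xi>))\<^sup>2" for y
  have f: "C2_function f (\<lambda>y. D\<psi> y + (1 / (2 * \<delta>)) *\<^sub>R (2 *\<^sub>R (y - \<xi>))) (\<lambda>y. D2\<psi> y + (1 / (2 * \<delta>)) *\<^sub>R mat 2)"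
    unfolding f_def by (intro C2_add C2_cmult C2_norm_sq \<psi>)
  have "f x \<le> f y" if "dist y x < e" for y
    using e(2)[OF that] sup_conv_ge[of \<xi> y] \<xi> by (simp add: f_def sup_conv_point_def norm_minus_commute)
  then have min: "\<forall>\<^sub>F y in nhds x. f x \<le> f y"
    using e(1) by (auto simp: eventually_nhds_metric)
  show "D\<psi> x = (1 / \<delta>) *\<^sub>R (\<xi> - x)"
    using C2_local_min(1)[OF f min] \<delta> by (simp add: add_eq_0_iff2 scaleR_right_diff_distrib)
  show "0 \<le> qform (D2\<psi> x) v + (norm v)\<^sup>2 / \<delta>"
    using C2_local_min(2)[OF f min, of v] \<delta>
    by (simp add: matrix_vector_mult_add_rdistrib scaleR_matrix_mult_vec inner_add_left mat_2_mult_vec power2_norm_eq_inner)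
qed

text \<open>At \<open>x\<close> the function is within a quadratic error of the affine function with slope \<open>p\<close>. A supporting paraboloid
  at \<open>x\<close> with a very different slope would therefore cross the upper paraboloid nearby.\<close>

lemma sup_conv_slope_estimate:
  assumes \<xi>: "sup_conv_point \<delta> \<phi> x \<xi>" and B: "0 \<le> B"
    and upper: "\<And>y. sup_conv \<delta> \<phi> y \<le> s + p \<bullet> (y - x0) + B * (norm (y - x0))\<^sup>2"
    and lower: "s + p \<bullet> (x - x0) - (norm (x - x0))\<^sup>2 / (2 * \<delta>) \<le> sup_conv \<delta> \<phi> x"
  shows "norm ((1 / \<delta>) *\<^sub>R (\<xi> - x) - p) \<le> 2 * (2 * B + 1 / (2 * \<delta>)) * norm (x - x0)"
proof -
  define C where "C = 2 * B + 1 / (2 * \<delta>)"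
  have C: "0 < C" using B \<delta> by (simp add: C_def add_nonneg_pos)
  define e where "e = x - x0"
  define g where "g = (1 / \<delta>) *\<^sub>R (\<xi> - x) - p"
  have main: "g \<bullet> f \<le> C * ((norm e)\<^sup>2 + (norm f)\<^sup>2)" for f
  proof -
    have "(norm (e + f))\<^sup>2 + (norm (e - f))\<^sup>2 = 2 * (norm e)\<^sup>2 + 2 * (norm f)\<^sup>2"
      by (simp add: power2_norm_eq_inner inner_simps)
    then have "B * (norm (e + f))\<^sup>2 \<le> B * (2 * (norm e)\<^sup>2 + 2 * (norm f)\<^sup>2)"
      using B by (intro mult_left_mono) (smt (verit) zero_le_power2, simp)
    moreover have "sup_conv \<delta> \<phi> (x + f) \<le> s + p \<bullet> (e + f) + B * (norm (e + f))\<^sup>2"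
      using upper[of "x + f"] by (simp add: e_def algebra_simps)
    moreover note sup_conv_supporting_paraboloid[OF \<xi>, of f] lower
    ultimately have "g \<bullet> f \<le> B * (2 * (norm e)\<^sup>2 + 2 * (norm f)\<^sup>2) + (norm e)\<^sup>2 / (2 * \<delta>) + (norm f)\<^sup>2 / (2 * \<delta>)"
      unfolding e_def[symmetric] g_def inner_diff_left inner_add_right by linarith
    also have "\<dots> = C * ((norm e)\<^sup>2 + (norm f)\<^sup>2)" by (simp add: C_def algebra_simps)
    finally show ?thesis .
  qed
  have "(norm g)\<^sup>2 / (2 * C) \<le> C * (norm e)\<^sup>2 + (norm g)\<^sup>2 / (4 * C)"
    \<comment> \<open>this displacement optimizes the quadratic inequality above\<close>
    using main[of "(1 / (2 * C)) *\<^sub>R g"] C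
    by (simp add: power2_norm_eq_inner power_mult_distrib power_divide dot_square_norm field_simps power2_eq_square)
  then have "(norm g)\<^sup>2 / (4 * C) \<le> C * (norm e)\<^sup>2" by (simp add: field_simps)
  then have "(norm g)\<^sup>2 \<le> (2 * C * norm e)\<^sup>2"
    using C by (simp add: field_simps power2_eq_square)
  then have "norm g \<le> 2 * C * norm e"
    by (rule power2_le_imp_le) (use C in simp)
  then show ?thesis by (simp add: g_def C_def e_def)
qed

lemma sup_conv_slope_unique:
  assumes "sup_conv_point \<delta> \<phi> x0 \<xi>0" "0 \<le> B"
    and "\<And>y. sup_conv \<delta> \<phi> y \<le> sup_conv \<delta> \<phi> x0 + p \<bullet> (y - x0) + B * (norm (y - x0))\<^sup>2"
  shows "(1 / \<delta>) *\<^sub>R (\<xi>0 - x0) = p"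
  using sup_conv_slope_estimate[OF assms(1,2,3)] by simp

lemma sup_conv_point_close:
  assumes \<xi>0: "sup_conv_point \<delta> \<phi> x0 \<xi>0" and B: "0 \<le> B"
    and upper: "\<And>y. sup_conv \<delta> \<phi> y \<le> sup_conv \<delta> \<phi> x0 + p \<bullet> (y - x0) + B * (norm (y - x0))\<^sup>2"
    and \<xi>: "sup_conv_point \<delta> \<phi> x \<xi>"
  shows "norm (\<xi> - \<xi>0) \<le> (4 * B * \<delta> + 2) * norm (x - x0)"
proof -
  define g where "g = (1 / \<delta>) *\<^sub>R (\<xi> - x) - p"
  have p: "(1 / \<delta>) *\<^sub>R (\<xi>0 - x0) = p" by (rule sup_conv_slope_unique[OF \<xi>0 B upper])
  have g: "norm g \<le> 2 * (2 * B + 1 / (2 * \<delta>)) * norm (x - x0)"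
    unfolding g_def
  proof (rule sup_conv_slope_estimate[OF \<xi> B upper])
    show "sup_conv \<delta> \<phi> x0 + p \<bullet> (x - x0) - (norm (x - x0))\<^sup>2 / (2 * \<delta>) \<le> sup_conv \<delta> \<phi> x"
      using sup_conv_supporting_paraboloid[OF \<xi>0, of "x - x0"] unfolding p by simp
  qed
  have "\<xi> - \<xi>0 = (x - x0) + \<delta> *\<^sub>R g"
    using \<delta> by (simp add: g_def p[symmetric] algebra_simps)
  then have "norm (\<xi> - \<xi>0) \<le> norm (x - x0) + \<delta> * norm g"
    using norm_triangle_ineq[of "x - x0" "\<delta> *\<^sub>R g"] \<delta> by simp
  also have "\<delta> * norm g \<le> \<delta> * (2 * (2 * B + 1 / (2 * \<delta>)) * norm (x - x0))"
    using g \<delta> by (intro mult_left_mono) auto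
  also have "norm (x - x0) + \<dots> = (4 * B * \<delta> + 2) * norm (x - x0)"
    using \<delta> by (simp add: field_simps)
  finally show ?thesis by simp
qed

end

section \<open>Freezing the coefficients\<close>

text \<open>The columns of a slightly enlarged \<open>S\<close> together with small steps along the axes: the trace along these steps is
  \<open>(1 + \<theta>) trace (S S\<^sup>T X) + \<theta> trace X\<close>.\<close>

definition frozen_steps :: "real \<Rightarrow> real ^ 'n ^ 'n \<Rightarrow> 'n + 'n \<Rightarrow> real ^ 'n" where
  "frozen_steps \<theta> S = case_sum (\<lambda>i. sqrt (1 + \<theta>) *\<^sub>R column i S) (\<lambda>i. sqrt \<theta> *\<^sub>R axis i 1)"

lemma sum_over_sum_type:
  fixes f :: "'a::finite + 'b::finite \<Rightarrow> 'c::comm_monoid_add"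
  shows "(\<Sum>j\<in>UNIV. f j) = (\<Sum>i\<in>UNIV. f (Inl i)) + (\<Sum>i\<in>UNIV. f (Inr i))"
  by (simp add: UNIV_Plus_UNIV[symmetric] sum.Plus del: UNIV_Plus_UNIV)

lemma energy_frozen_steps:
  fixes S :: "real ^ 'n ^ 'n"
  assumes "0 \<le> \<theta>"
  shows "energy (frozen_steps \<theta> S) = (1 + \<theta>) * (\<Sum>i\<in>UNIV. (norm (column i S))\<^sup>2) + \<theta> * CARD('n)"
  using assms
  by (simp add: sum_over_sum_type frozen_steps_def power_mult_distrib sum_distrib_left norm_axis_1)

text \<open>The steps along the axes cancel, so the coupled walks do not see the added Laplacian.\<close>

lemma energy_frozen_steps_diff:
  assumes "0 \<le> \<theta>"
  shows "energy (\<lambda>j. frozen_steps \<theta> S j - frozen_steps \<theta> S' j)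
     = (1 + \<theta>) * (\<Sum>i\<in>UNIV. (norm (column i S - column i S'))\<^sup>2)"
  using assms
  by (simp add: sum_over_sum_type frozen_steps_def power_mult_distrib sum_distrib_left
      scaleR_diff_right[symmetric])

text \<open>Young's inequality for the form, followed by an estimate of the form by the trace. The two mixed
  terms always stay together because \<open>X\<close> need not be symmetric.\<close>

lemma nonneg_qform_perturb:
  fixes X :: "real ^ 'n ^ 'n"
  assumes pos: "\<And>v. 0 \<le> qform X v" and t: "0 < t"
  shows "qform X b \<le> (1 + t) * qform X a
      + (1 + 1 / t) * (CARD('n) * (norm (b - a))\<^sup>2 * (\<Sum>i\<in>UNIV. qform X (axis i 1)))"
proof -
  define e where "e = b - a"
  define w where "w = sqrt t *\<^sub>R a - (1 / sqrt t) *\<^sub>R e"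
  have st: "sqrt t * sqrt t = t" "sqrt t \<noteq> 0" using t by auto
  have "0 \<le> qform X w" by (rule pos)
  also have "qform X w = t * qform X a + (1 / t) * qform X e - ((X *v a) \<bullet> e + (X *v e) \<bullet> a)"
  proof -
    have "qform X w = (sqrt t * sqrt t) * qform X a + (1 / (sqrt t * sqrt t)) * qform X e
        - (sqrt t * (1 / sqrt t)) * ((X *v a) \<bullet> e + (X *v e) \<bullet> a)"
      unfolding w_def matrix_vector_mult_diff_distrib matrix_vector_mult_scaleR
      by (simp add: inner_diff_left inner_diff_right algebra_simps)
    then show ?thesis using st by simp
  qed
  finally have cross: "(X *v a) \<bullet> e + (X *v e) \<bullet> a \<le> t * qform X a + (1 / t) * qform X e" by simp
  have "b = a + e" by (simp add: e_def)
  then have "qform X b = qform X a + qform X e + ((X *v a) \<bullet> e + (X *v e) \<bullet> a)"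
    by (simp add: matrix_vector_right_distrib inner_simps)
  then have 1: "qform X b \<le> (1 + t) * qform X a + (1 + 1 / t) * qform X e"
    using cross by (simp add: algebra_simps)
  have e_sum: "e = (\<Sum>i\<in>UNIV. e $ i *\<^sub>R axis i 1)"
    using basis_expansion[of e] by (simp add: scalar_mult_eq_scaleR)
  define x where "x i j = (X *v axis i 1) \<bullet> axis j 1" for i j
  have expand: "qform X e = (\<Sum>i\<in>UNIV. \<Sum>j\<in>UNIV. e $ i * e $ j * x i j)"
  proof -
    have "X *v e = (\<Sum>i\<in>UNIV. e $ i *\<^sub>R (X *v axis i 1))"
      by (subst e_sum) (simp add: linear_sum[OF matrix_vector_mul_linear] matrix_vector_mult_scaleR)
    then have "qform X e = (\<Sum>i\<in>UNIV. e $ i *\<^sub>R (X *v axis i 1)) \<bullet> (\<Sum>j\<in>UNIV. e $ j *\<^sub>R axis j 1)"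
      using e_sum by metis
    then show ?thesis
      by (simp only: inner_sum_left) (simp add: inner_sum_right x_def sum_distrib_left mult_ac)
  qed
  have pair: "e $ i * e $ j * x i j + e $ j * e $ i * x j i \<le> (e $ i)\<^sup>2 * x i i + (e $ j)\<^sup>2 * x j j" for i j
  proof -
    have "0 \<le> qform X (e $ i *\<^sub>R axis i 1 - e $ j *\<^sub>R axis j 1)" by (rule pos)
    also have "\<dots> = (e $ i)\<^sup>2 * x i i + (e $ j)\<^sup>2 * x j j - (e $ i * e $ j * x i j + e $ j * e $ i * x j i)"
      unfolding matrix_vector_mult_diff_distrib matrix_vector_mult_scaleR x_def
      by (simp add: inner_diff_left inner_diff_right algebra_simps power2_eq_square)
    finally show ?thesis by simp
  qed
  have "2 * qform X e = (\<Sum>i\<in>UNIV. \<Sum>j\<in>UNIV. e $ i * e $ j * x i j + e $ j * e $ i * x j i)"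
    unfolding expand sum.distrib sum.swap[of "\<lambda>i j. e $ j * e $ i * x j i"] by simp
  also have "\<dots> \<le> (\<Sum>i\<in>UNIV. \<Sum>j\<in>(UNIV::'n set). (e $ i)\<^sup>2 * x i i + (e $ j)\<^sup>2 * x j j)"
    by (intro sum_mono pair)
  also have "\<dots> = 2 * (CARD('n) * (\<Sum>i\<in>UNIV. (e $ i)\<^sup>2 * x i i))"
    by (simp add: sum.distrib sum_distrib_left)
  also have "\<dots> \<le> 2 * (CARD('n) * (\<Sum>i\<in>UNIV. (norm e)\<^sup>2 * x i i))"
  proof (intro mult_left_mono sum_mono mult_right_mono)
    fix i
    have "\<bar>e $ i\<bar> \<le> norm e" by (rule component_le_norm_cart)
    then show "(e $ i)\<^sup>2 \<le> (norm e)\<^sup>2" by (metis abs_ge_zero power2_abs power_mono)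
    show "0 \<le> x i i" unfolding x_def by (rule pos)
  qed auto
  finally have "qform X e \<le> CARD('n) * (norm e)\<^sup>2 * (\<Sum>i\<in>UNIV. x i i)"
    by (simp add: sum_distrib_left[symmetric] mult.assoc)
  then have "(1 + 1 / t) * qform X e \<le> (1 + 1 / t) * (CARD('n) * (norm e)\<^sup>2 * (\<Sum>i\<in>UNIV. x i i))"
    using t by (intro mult_left_mono) auto
  with 1 show ?thesis by (simp add: e_def x_def)
qed

text \<open>Shifting \<open>X\<close> by \<open>1 / \<delta>\<close> makes the form nonnegative. A trace with the nearby matrix \<open>S\<close> is then controlled by that
  with \<open>S0\<close> however large \<open>X\<close> is, because the error is absorbed by the additional Laplacian.\<close>

lemma trace_frozen_steps_ge:
  fixes S S0 X :: "real ^ 'n ^ 'n"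
  assumes X: "\<And>v. 0 \<le> qform X v + (norm v)\<^sup>2 / \<delta>" and \<theta>: "0 < \<theta>"
    and near: "(1 + 1 / \<theta>) * (CARD('n) * (\<Sum>i\<in>UNIV. (norm (column i S - column i S0))\<^sup>2)) \<le> \<theta>"
  shows "trace_along (\<lambda>i. column i S) X + (\<Sum>i\<in>UNIV. (norm (column i S))\<^sup>2) / \<delta>
     \<le> trace_along (frozen_steps \<theta> S0) X + energy (frozen_steps \<theta> S0) / \<delta>"
proof -
  define Y where "Y = X + (1 / \<delta>) *\<^sub>R mat 1"
  have Y: "qform Y v = qform X v + (norm v)\<^sup>2 / \<delta>" for v
    by (simp add: Y_def matrix_vector_mult_add_rdistrib scaleR_matrix_mult_vec inner_add_left
        power2_norm_eq_inner)
  have trY: "trace_along c Y = trace_along c X + energy c / \<delta>" for c :: "'k::finite \<Rightarrow> real ^ 'n"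
    by (simp add: Y sum.distrib sum_divide_distrib)
  have pos: "0 \<le> qform Y v" for v unfolding Y by (rule X)
  define E where "E = (\<Sum>i\<in>UNIV. qform Y (axis i 1))"
  have E: "0 \<le> E" unfolding E_def by (intro sum_nonneg pos)
  have "trace_along (\<lambda>i. column i S) Y
     \<le> (\<Sum>i\<in>UNIV. (1 + \<theta>) * qform Y (column i S0)
           + (1 + 1 / \<theta>) * (CARD('n) * (norm (column i S - column i S0))\<^sup>2 * E))"
    unfolding E_def by (intro sum_mono nonneg_qform_perturb pos \<theta>)
  also have "\<dots> = (1 + \<theta>) * (\<Sum>i\<in>UNIV. qform Y (column i S0))
      + (1 + 1 / \<theta>) * (CARD('n) * (\<Sum>i\<in>UNIV. (norm (column i S - column i S0))\<^sup>2)) * E"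
    by (simp add: sum.distrib sum_distrib_left sum_distrib_right mult_ac)
  also have "\<dots> \<le> (1 + \<theta>) * (\<Sum>i\<in>UNIV. qform Y (column i S0)) + \<theta> * E"
    using near E by (intro add_left_mono mult_right_mono)
  also have "\<dots> = trace_along (frozen_steps \<theta> S0) Y"
  proof -
    have "qform Y (sqrt s *\<^sub>R v) = s * qform Y v" if "0 \<le> s" for s v
      using that by (simp add: matrix_vector_mult_scaleR)
    then show ?thesis
      using \<theta> by (simp add: sum_over_sum_type frozen_steps_def E_def sum_distrib_left)
  qed
  finally show ?thesis by (simp add: trY)
qed

text \<open>Freezing at \<open>x0\<close>: for \<open>x\<close> near \<open>x0\<close> the maximizer \<open>\<xi>\<close> and the slope \<open>(\<xi> - x) / \<delta>\<close> are close to \<open>\<xi>0\<close> and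
  \<open>p\<close>, so \<open>F\<close> and \<open>\<sigma>\<close> may be evaluated there. What remains of the shift of \<open>X\<close> by \<open>1 / \<delta>\<close> is of
  order \<open>\<theta> / \<delta>\<close>.\<close>

lemma (in sup_convolution) sup_conv_trace_subsolution:
  fixes \<sigma> :: "real ^ 'n \<Rightarrow> real ^ 'n ^ 'n"
  assumes \<sigma>: "continuous_on UNIV \<sigma>" and F: "continuous_on UNIV (\<lambda>(x, p). F x p)"
    and sub: "viscosity_subsolution (\<lambda>x _ p X. F x p - trace_along (\<lambda>i. column i (\<sigma> x)) X) \<phi>"
    and \<xi>0: "sup_conv_point \<delta> \<phi> x0 \<xi>0" and B: "0 \<le> B"
    and upper: "\<And>y. sup_conv \<delta> \<phi> y \<le> sup_conv \<delta> \<phi> x0 + p \<bullet> (y - x0) + B * (norm (y - x0))\<^sup>2"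
    and \<theta>: "0 < \<theta>"
    and small: "\<theta> * ((\<Sum>i\<in>UNIV. (norm (column i (\<sigma> \<xi>0)))\<^sup>2) + CARD('n)) / \<delta> < e"
  obtains r where "0 < r"
    "trace_subsolution (frozen_steps \<theta> (\<sigma> \<xi>0)) (F \<xi>0 p - e) x0 r (sup_conv \<delta> \<phi>)"
proof -
  define T where "T \<xi> = (\<Sum>i\<in>UNIV. (norm (column i (\<sigma> \<xi>)))\<^sup>2)" for \<xi>
  define V where "V \<xi> = (1 + 1 / \<theta>) * (CARD('n) * (\<Sum>i\<in>UNIV. (norm (column i (\<sigma> \<xi>) - column i (\<sigma> \<xi>0)))\<^sup>2))" for \<xi>
  \<comment> \<open>the inequality to be shown is an open condition on the pair of x and its maximizer\<close>
  define G where "G z = F (snd z) ((1 / \<delta>) *\<^sub>R (snd z - fst z))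
      + T (snd z) / \<delta> - energy (frozen_steps \<theta> (\<sigma> \<xi>0)) / \<delta>" for z :: "(real ^ 'n) \<times> (real ^ 'n)"
  have contT: "continuous_on UNIV T" and contV: "continuous_on UNIV V"
  proof -
    have col: "continuous_on UNIV (\<lambda>\<xi>. column i (\<sigma> \<xi>))" for i
      unfolding column_def by (intro continuous_intros \<sigma>)
    show "continuous_on UNIV T" "continuous_on UNIV V"
      unfolding T_def V_def by (intro continuous_intros col)+
  qed
  have contG: "continuous_on UNIV G"
    unfolding G_def
    using \<delta> by (intro continuous_intros continuous_on_compose2[OF contT]
        continuous_on_compose2[OF F, of UNIV "\<lambda>z. (snd z, (1 / \<delta>) *\<^sub>R (snd z - fst z))", simplified]) auto
  have contV2: "continuous_on UNIV (\<lambda>z :: (real ^ 'n) \<times> (real ^ 'n). V (snd z))"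
    by (intro continuous_on_compose2[OF contV] continuous_intros) auto
  define W where "W = {z. F \<xi>0 p - e < G z} \<inter> {z. V (snd z) < \<theta>}"
  have "open W"
    unfolding W_def by (intro open_Int open_Collect_less contG contV2 continuous_on_const)
  have p: "(1 / \<delta>) *\<^sub>R (\<xi>0 - x0) = p" by (rule sup_conv_slope_unique[OF \<xi>0 B upper])
  have split: "(1 + \<theta>) * T \<xi>0 + \<theta> * CARD('n) = T \<xi>0 + \<theta> * (T \<xi>0 + CARD('n))"
    by (simp add: algebra_simps)
  have "G (x0, \<xi>0) = F \<xi>0 p - \<theta> * (T \<xi>0 + CARD('n)) / \<delta>"
    unfolding G_def fst_conv snd_conv p energy_frozen_steps[OF less_imp_le[OF \<theta>]] T_def[symmetric] split
      add_divide_distrib by simp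
  then have "(x0, \<xi>0) \<in> W"
    using \<theta> small by (simp add: W_def V_def T_def)
  then obtain \<rho> where \<rho>: "0 < \<rho>" "\<And>z. dist z (x0, \<xi>0) < \<rho> \<Longrightarrow> z \<in> W"
    using \<open>open W\<close> unfolding open_dist by blast
  define C where "C = 1 + (4 * B * \<delta> + 2)"
  have C: "0 < C" using B \<delta> by (simp add: C_def add_pos_nonneg)
  show ?thesis
  proof (rule that)
    show "0 < \<rho> / C" using \<rho>(1) C by simp
    show "trace_subsolution (frozen_steps \<theta> (\<sigma> \<xi>0)) (F \<xi>0 p - e) x0 (\<rho> / C) (sup_conv \<delta> \<phi>)"
      unfolding trace_subsolution_def
    proof (intro allI impI)
      fix \<psi> D\<psi> D2\<psi> x
      assume \<psi>: "C2_function \<psi> D\<psi> D2\<psi>" and x: "dist x x0 < \<rho> / C"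
        and touch: "\<forall>\<^sub>F y in nhds x. sup_conv \<delta> \<phi> y - \<psi> y \<le> sup_conv \<delta> \<phi> x - \<psi> x"
      obtain \<xi> where \<xi>: "sup_conv_point \<delta> \<phi> x \<xi>" using sup_conv_attained .
      have "dist (x, \<xi>) (x0, \<xi>0) \<le> dist x x0 + dist \<xi> \<xi>0"
        unfolding dist_Pair_Pair by (rule sqrt_sum_squares_le_sum) auto
      also have "\<dots> \<le> C * dist x x0"
        using sup_conv_point_close[OF \<xi>0 B upper \<xi>] by (simp add: C_def dist_norm algebra_simps)
      also have "\<dots> < \<rho>" using x C by (simp add: pos_less_divide_eq mult.commute)
      finally have "(x, \<xi>) \<in> W" by (rule \<rho>(2))
      then have G: "F \<xi>0 p - e < G (x, \<xi>)" and V: "V \<xi> < \<theta>" by (auto simp: W_def)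
      note t = sup_conv_touching[OF \<psi> \<xi> touch]
      have "F \<xi> (D\<psi> (\<xi> + (x - \<xi>))) \<le> trace_along (\<lambda>i. column i (\<sigma> \<xi>)) (D2\<psi> (\<xi> + (x - \<xi>)))"
        using sub C2_translate[OF \<psi>] t(1) unfolding viscosity_subsolution_def by fastforce
      then have "F \<xi> ((1 / \<delta>) *\<^sub>R (\<xi> - x)) \<le> trace_along (\<lambda>i. column i (\<sigma> \<xi>)) (D2\<psi> x)"
        by (simp add: t(2))
      then have "G (x, \<xi>) \<le> trace_along (frozen_steps \<theta> (\<sigma> \<xi>0)) (D2\<psi> x)"
        using trace_frozen_steps_ge[OF t(3) \<theta>, of "\<sigma> \<xi>" "\<sigma> \<xi>0"] V by (simp add: G_def V_def T_def)
      then show "F \<xi>0 p - e \<le> trace_along (frozen_steps \<theta> (\<sigma> \<xi>0)) (D2\<psi> x)"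
        using G by simp
    qed
  qed
qed

section \<open>Doubling of variables\<close>

text \<open>The consequence of the theorem on sums for two subsolutions with the same linear second-order part. The points
  \<open>\<xi>0\<close> and \<open>\<zeta>0\<close> lie beyond \<open>x0\<close> and \<open>y0\<close> on the line through them, so their distance is
  known exactly.\<close>

proposition doubling_inequality:
  fixes \<sigma> :: "real ^ 'n \<Rightarrow> real ^ 'n ^ 'n"
  assumes bc1: "sup_convolution \<phi>1 M1 \<delta>" and bc2: "sup_convolution \<phi>2 M2 \<delta>"
    and per: "torus_periodic \<phi>1" "torus_periodic \<phi>2"
    and \<sigma>: "continuous_on UNIV \<sigma>"
    and F1: "continuous_on UNIV (\<lambda>(x, p). F1 x p)" and F2: "continuous_on UNIV (\<lambda>(x, p). F2 x p)"
    and sub1: "viscosity_subsolution (\<lambda>x _ p X. F1 x p - trace_along (\<lambda>i. column i (\<sigma> x)) X) \<phi>1"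
    and sub2: "viscosity_subsolution (\<lambda>x _ p X. F2 x p - trace_along (\<lambda>i. column i (\<sigma> x)) X) \<phi>2"
    and \<xi>0: "sup_conv_point \<delta> \<phi>1 x0 \<xi>0" and \<zeta>0: "sup_conv_point \<delta> \<phi>2 y0 \<zeta>0" and B: "0 \<le> B"
    and max: "\<And>x y. sup_conv \<delta> \<phi>1 x + sup_conv \<delta> \<phi>2 y
        \<le> sup_conv \<delta> \<phi>1 x0 + sup_conv \<delta> \<phi>2 y0 + B * ((norm (x - y))\<^sup>2 - (norm (x0 - y0))\<^sup>2)"
    and p: "p = (2 * B) *\<^sub>R (x0 - y0)"
  shows "F1 \<xi>0 p + F2 \<zeta>0 (- p) \<le> 2 * B * (\<Sum>i\<in>UNIV. (norm (column i (\<sigma> \<xi>0) - column i (\<sigma> \<zeta>0)))\<^sup>2)"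
    and "\<xi>0 = x0 + \<delta> *\<^sub>R p" and "\<zeta>0 = y0 - \<delta> *\<^sub>R p"
proof -
  interpret b1: sup_convolution \<phi>1 M1 \<delta> by (rule bc1)
  interpret b2: sup_convolution \<phi>2 M2 \<delta> by (rule bc2)
  have \<delta>: "0 < \<delta>" by (rule b1.\<delta>)
  have square: "(norm (a - c))\<^sup>2 - (norm (b - c))\<^sup>2 = (2 *\<^sub>R (b - c)) \<bullet> (a - b) + (norm (a - b))\<^sup>2"
    for a b c :: "real ^ 'n"
    by (simp add: power2_norm_eq_inner inner_simps inner_commute algebra_simps)
  have upper1: "sup_conv \<delta> \<phi>1 x \<le> sup_conv \<delta> \<phi>1 x0 + p \<bullet> (x - x0) + B * (norm (x - x0))\<^sup>2" for x
    using max[of x y0] unfolding square p by (simp add: algebra_simps)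
  have upper2: "sup_conv \<delta> \<phi>2 y \<le> sup_conv \<delta> \<phi>2 y0 + (- p) \<bullet> (y - y0) + B * (norm (y - y0))\<^sup>2" for y
    using max[of x0 y] square[of y x0 y0] unfolding norm_minus_commute[of x0] square p
    by (simp add: algebra_simps)
  have "(1 / \<delta>) *\<^sub>R (\<xi>0 - x0) = p" "(1 / \<delta>) *\<^sub>R (\<zeta>0 - y0) = - p"
    by (rule b1.sup_conv_slope_unique[OF \<xi>0 B upper1] b2.sup_conv_slope_unique[OF \<zeta>0 B upper2])+
  then have "\<delta> *\<^sub>R p = \<xi>0 - x0" "\<delta> *\<^sub>R (- p) = \<zeta>0 - y0"
    using \<delta> by (metis (no_types, lifting) divide_self_if less_irrefl scaleR_one scaleR_scaleR times_divide_eq_right mult.right_neutral)+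
  then show "\<xi>0 = x0 + \<delta> *\<^sub>R p" "\<zeta>0 = y0 - \<delta> *\<^sub>R p"
    by (simp_all add: algebra_simps)
  define T1 where "T1 = (\<Sum>i\<in>UNIV. (norm (column i (\<sigma> \<xi>0)))\<^sup>2)"
  define T2 where "T2 = (\<Sum>i\<in>UNIV. (norm (column i (\<sigma> \<zeta>0)))\<^sup>2)"
  define S where "S = (\<Sum>i\<in>UNIV. (norm (column i (\<sigma> \<xi>0) - column i (\<sigma> \<zeta>0)))\<^sup>2)"
  have T: "0 \<le> T1" "0 \<le> T2" "0 \<le> S" by (simp_all add: T1_def T2_def S_def sum_nonneg)
  have main: "F1 \<xi>0 p + F2 \<zeta>0 (- p) \<le> 2 * B * S + e * (2 + 2 * B * S)" if e: "0 < e" for e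
  proof -
    \<comment> \<open>theta is at most e, and small enough for the freezing error at both points\<close>
    define Q where "Q = \<delta> + T1 + T2 + CARD('n)"
    define \<theta> where "\<theta> = e * \<delta> / Q"
    have Q: "0 < Q" using \<delta> T by (simp add: Q_def add_pos_nonneg)
    have \<theta>: "0 < \<theta>" using e \<delta> Q by (simp add: \<theta>_def)
    have "e * \<delta> \<le> e * Q" using e T by (intro mult_left_mono) (auto simp: Q_def)
    then have \<theta>e: "\<theta> \<le> e" using Q by (simp add: \<theta>_def pos_divide_le_eq)
    have small: "\<theta> * t / \<delta> < e" if "t < Q" for t
    proof -
      have "\<theta> * t / \<delta> = e * t / Q" using \<delta> by (simp add: \<theta>_def)
      also have "\<dots> < e" using that e Q by (simp add: pos_divide_less_eq)
      finally show ?thesis .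
    qed
    have "\<theta> * (T1 + CARD('n)) / \<delta> < e" "\<theta> * (T2 + CARD('n)) / \<delta> < e"
      by (rule small, use \<delta> T in \<open>simp add: Q_def\<close>)+
    note small = this[unfolded T1_def T2_def]
    obtain r1 where r1: "0 < r1"
      "trace_subsolution (frozen_steps \<theta> (\<sigma> \<xi>0)) (F1 \<xi>0 p - e) x0 r1 (sup_conv \<delta> \<phi>1)"
      using b1.sup_conv_trace_subsolution[OF \<sigma> F1 sub1 \<xi>0 B upper1 \<theta> small(1)] by blast
    obtain r2 where r2: "0 < r2"
      "trace_subsolution (frozen_steps \<theta> (\<sigma> \<zeta>0)) (F2 \<zeta>0 (- p) - e) y0 r2 (sup_conv \<delta> \<phi>2)"
      using b2.sup_conv_trace_subsolution[OF \<sigma> F2 sub2 \<zeta>0 B upper2 \<theta> small(2)] by blast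
    have "(F1 \<xi>0 p - e) + (F2 \<zeta>0 (- p) - e)
        \<le> 2 * B * energy (\<lambda>j. frozen_steps \<theta> (\<sigma> \<xi>0) j - frozen_steps \<theta> (\<sigma> \<zeta>0) j)"
      by (rule coupling_inequality[OF b1.sup_conv_periodic[OF per(1)] b1.sup_conv_continuous
            b2.sup_conv_periodic[OF per(2)] b2.sup_conv_continuous max r1(1) r2(1) r1(2) r2(2)])
    also have "\<dots> = 2 * B * ((1 + \<theta>) * S)"
      unfolding S_def energy_frozen_steps_diff[OF less_imp_le[OF \<theta>]] ..
    also have "\<dots> = 2 * B * S + \<theta> * (2 * B * S)" by (simp add: algebra_simps)
    also have "\<theta> * (2 * B * S) \<le> e * (2 * B * S)" using \<theta>e B T by (intro mult_right_mono) auto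
    finally show ?thesis by (simp add: algebra_simps)
  qed
  define W where "W = 2 + 2 * B * S"
  have W: "0 < W" using B T by (simp add: W_def add_pos_nonneg)
  have "F1 \<xi>0 p + F2 \<zeta>0 (- p) \<le> 2 * B * S + e" if "0 < e" for e
    using main[of "e / W"] W that by (simp add: W_def[symmetric])
  then show "F1 \<xi>0 p + F2 \<zeta>0 (- p) \<le> 2 * B * (\<Sum>i\<in>UNIV. (norm (column i (\<sigma> \<xi>0) - column i (\<sigma> \<zeta>0)))\<^sup>2)"
    unfolding S_def[symmetric] by (rule field_le_epsilon)
qed

section \<open>The gradient bound\<close>

lemma trace_mult_transpose:
  fixes S X :: "real ^ 'n ^ 'n"
  shows "trace ((S ** transpose S) ** X) = trace_along (\<lambda>i. column i S) X"
proof -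
  have "trace ((S ** transpose S) ** X) = (\<Sum>i\<in>UNIV. \<Sum>j\<in>UNIV. \<Sum>k\<in>UNIV. S $ i $ k * S $ j $ k * X $ j $ i)"
    by (simp add: trace_def matrix_matrix_mult_def transpose_def sum_distrib_right)
  also have "\<dots> = (\<Sum>j\<in>UNIV. \<Sum>i\<in>UNIV. \<Sum>k\<in>UNIV. S $ i $ k * S $ j $ k * X $ j $ i)"
    by (rule sum.swap)
  also have "\<dots> = (\<Sum>j\<in>UNIV. \<Sum>k\<in>UNIV. \<Sum>i\<in>UNIV. S $ i $ k * S $ j $ k * X $ j $ i)"
    by (intro sum.cong refl sum.swap)
  also have "\<dots> = (\<Sum>k\<in>UNIV. \<Sum>j\<in>UNIV. \<Sum>i\<in>UNIV. S $ i $ k * S $ j $ k * X $ j $ i)"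
    by (rule sum.swap)
  also have "\<dots> = trace_along (\<lambda>i. column i S) X"
    by (simp add: matrix_vector_mult_def inner_vec_def column_def sum_distrib_left sum_distrib_right mult_ac)
  finally show ?thesis .
qed

lemma torus_dist_le_norm: "torus_dist x y \<le> norm (x - y)" and torus_dist_nonneg: "0 \<le> torus_dist x y"
proof -
  have "bdd_below ((\<lambda>k. norm (x - y + k)) ` int_lattice)" by (intro bdd_belowI2[of _ 0]) simp
  then show "torus_dist x y \<le> norm (x - y)"
    unfolding torus_dist_def using cINF_lower[of "\<lambda>k. norm (x - y + k)" int_lattice 0] int_lattice_zero_neg(1)
    by simp
  show "0 \<le> torus_dist x y"
    unfolding torus_dist_def using int_lattice_zero_neg(1) by (intro cINF_greatest) auto
qed

text \<open>The infimum is attained, as the defining inequalities are closed in the constant.\<close>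

lemma best_lipschitz:
  assumes "W1inf_torus \<sigma>"
  shows "torus_lipschitz (best_lipschitz \<sigma>) \<sigma>"
proof -
  define X where "X = {C. torus_lipschitz C \<sigma>}"
  have ne: "X \<noteq> {}" using assms by (auto simp: X_def W1inf_torus_def)
  have "0 \<le> Inf X" using ne by (intro cInf_greatest) (auto simp: X_def torus_lipschitz_def)
  moreover have "onorm ((*v) (\<sigma> x - \<sigma> y)) \<le> Inf X * torus_dist x y" for x y
  proof (cases "torus_dist x y = 0")
    case True
    obtain C where "torus_lipschitz C \<sigma>" using ne by (auto simp: X_def)
    then have "onorm ((*v) (\<sigma> x - \<sigma> y)) \<le> C * torus_dist x y" by (simp add: torus_lipschitz_def)
    with True show ?thesis by simp
  next
    case False
    then have pos: "0 < torus_dist x y" using torus_dist_nonneg[of x y] by simp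
    have "onorm ((*v) (\<sigma> x - \<sigma> y)) / torus_dist x y \<le> Inf X"
      using ne pos by (intro cInf_greatest) (auto simp: X_def torus_lipschitz_def pos_divide_le_eq)
    then show ?thesis using pos by (simp add: pos_divide_le_eq)
  qed
  ultimately show ?thesis by (simp add: torus_lipschitz_def best_lipschitz_def X_def)
qed

lemma torus_lipschitz_norm:
  fixes \<sigma> :: "real ^ 'n \<Rightarrow> real ^ 'n ^ 'n"
  assumes "torus_lipschitz C \<sigma>"
  shows "onorm ((*v) (\<sigma> x - \<sigma> y)) \<le> C * norm (x - y)"
proof -
  have "onorm ((*v) (\<sigma> x - \<sigma> y)) \<le> C * torus_dist x y" "0 \<le> C"
    using assms by (auto simp: torus_lipschitz_def)
  then show ?thesis using mult_left_mono[OF torus_dist_le_norm[of x y], of C] by linarith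
qed

lemma torus_lipschitz_continuous:
  fixes \<sigma> :: "real ^ 'n \<Rightarrow> real ^ 'n ^ 'n"
  assumes "torus_lipschitz C \<sigma>"
  shows "continuous_on UNIV \<sigma>"
proof -
  have C: "0 \<le> C" using assms by (simp add: torus_lipschitz_def)
  have "continuous_on UNIV (\<lambda>x. \<sigma> x $ i $ j)" for i j
  proof (rule lipschitz_on_continuous_on[of C], rule lipschitz_onI)
    fix x y
    have "\<bar>(\<sigma> x - \<sigma> y) $ i $ j\<bar> \<le> onorm ((*v) (\<sigma> x - \<sigma> y))"
      by (rule matrix_component_le_onorm)
    also have "\<dots> \<le> C * norm (x - y)" by (rule torus_lipschitz_norm[OF assms])
    finally show "dist (\<sigma> x $ i $ j) (\<sigma> y $ i $ j) \<le> C * dist x y"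
      by (simp add: dist_norm)
  qed (rule C)
  then have "continuous_on UNIV (\<lambda>x. \<chi> i j. \<sigma> x $ i $ j)"
    by (intro continuous_on_vec_lambda)
  then show ?thesis by simp
qed

text \<open>The sum over the columns is the squared Frobenius norm, which costs a factor \<open>N\<close> over the operator norm.\<close>

lemma torus_lipschitz_columns:
  fixes \<sigma> :: "real ^ 'n \<Rightarrow> real ^ 'n ^ 'n" and C :: real
  assumes "torus_lipschitz C \<sigma>"
  shows "(\<Sum>i\<in>UNIV. (norm (column i (\<sigma> x) - column i (\<sigma> y)))\<^sup>2) \<le> CARD('n) * C\<^sup>2 * (norm (x - y))\<^sup>2"
proof -
  have "(norm (column i (\<sigma> x) - column i (\<sigma> y)))\<^sup>2 \<le> (C * norm (x - y))\<^sup>2" for i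
  proof (rule power_mono)
    have "column i (\<sigma> x) - column i (\<sigma> y) = (\<sigma> x - \<sigma> y) *v axis i 1"
      by (simp add: matrix_vector_mul_component vec_eq_iff column_def inner_axis)
    also have "norm \<dots> \<le> onorm ((*v) (\<sigma> x - \<sigma> y)) * norm (axis i 1 :: real ^ 'n)"
      by (rule onorm) (rule matrix_vector_mul_bounded_linear)
    also have "\<dots> \<le> C * norm (x - y)" using torus_lipschitz_norm[OF assms] by simp
    finally show "norm (column i (\<sigma> x) - column i (\<sigma> y)) \<le> C * norm (x - y)" .
  qed simp
  then have "(\<Sum>i\<in>UNIV. (norm (column i (\<sigma> x) - column i (\<sigma> y)))\<^sup>2) \<le> (\<Sum>i\<in>(UNIV::'n set). (C * norm (x - y))\<^sup>2)"
    by (rule sum_mono)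
  then show ?thesis by (simp add: power_mult_distrib mult.assoc)
qed

lemma lattice_point_near: "\<exists>k\<in>int_lattice. norm (z - k) \<le> sqrt (CARD('n)) / 2" for z :: "real ^ 'n"
proof
  define k :: "real ^ 'n" where "k = (\<chi> i. of_int (round (z $ i)))"
  show "k \<in> int_lattice" by (simp add: int_lattice_def k_def)
  have "(norm (z - k))\<^sup>2 = (\<Sum>i\<in>UNIV. ((z - k) $ i)\<^sup>2)"
    unfolding power2_norm_eq_inner inner_vec_def by (simp add: power2_eq_square)
  also have "\<dots> \<le> (\<Sum>i\<in>(UNIV::'n set). (1 / 2)\<^sup>2)"
  proof (rule sum_mono)
    fix i
    have "\<bar>(z - k) $ i\<bar> \<le> 1 / 2"
      using of_int_round_abs_le[of "z $ i"] by (simp add: k_def abs_minus_commute)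
    then show "((z - k) $ i)\<^sup>2 \<le> (1 / 2)\<^sup>2" by (metis abs_ge_zero power2_abs power_mono)
  qed
  also have "\<dots> = (sqrt (CARD('n)) / 2)\<^sup>2" by (simp add: power_divide)
  finally show "norm (z - k) \<le> sqrt (CARD('n)) / 2"
    by (rule power2_le_imp_le) simp
qed

lemma torus_periodic_max:
  fixes f :: "real ^ 'n \<Rightarrow> real"
  assumes per: "torus_periodic f" and cont: "continuous_on UNIV f"
  obtains z where "\<And>y. f y \<le> f z"
proof -
  obtain z where z: "\<forall>y\<in>cbox 0 1. f y \<le> f z"
    using continuous_attains_sup[of "cbox 0 1" f] continuous_on_subset[OF cont] lattice_shift_into_cube
    by (metis compact_cbox empty_iff subset_UNIV)
  have "f y \<le> f z" for y
    using lattice_shift_into_cube[of y] per z unfolding torus_periodic_def by metis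
  then show ?thesis by (rule that)
qed

text \<open>A common lattice translation brings the first variable into the unit cube, and the penalization keeps the second one
  close to the first.\<close>

lemma penalized_sum_max:
  fixes u1 u2 :: "real ^ 'n \<Rightarrow> real"
  assumes u1: "torus_periodic u1" "continuous_on UNIV u1"
    and u2: "torus_periodic u2" "continuous_on UNIV u2" and L: "0 < L"
  obtains x0 y0 where "\<And>x y. u1 x + u2 y - L * norm (x - y) \<le> u1 x0 + u2 y0 - L * norm (x0 - y0)"
proof -
  obtain M1 where M1: "M1 > 0" "\<And>x. norm (u1 x) \<le> M1" using torus_periodic_bounded[OF u1] by blast
  obtain M2 where M2: "M2 > 0" "\<And>x. norm (u2 x) \<le> M2" using torus_periodic_bounded[OF u2] by blast
  have "bounded (cbox 0 (1 :: real ^ 'n))" by (rule bounded_cbox)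
  then obtain b where b: "0 < b" "\<And>x. x \<in> cbox 0 (1 :: real ^ 'n) \<Longrightarrow> norm x \<le> b"
    unfolding bounded_pos by blast
  define R where "R = 2 * (M1 + M2) / L"
  have R: "0 < R" "L * R = 2 * (M1 + M2)" using M1 M2 L by (auto simp: R_def)
  define K where "K = cbox 0 (1 :: real ^ 'n) \<times> cball (0 :: real ^ 'n) (b + R)"
  define f where "f z = u1 (fst z) + u2 (snd z) - L * norm (fst z - snd z)" for z
  have "compact K" unfolding K_def by (intro compact_Times compact_cbox compact_cball)
  moreover have 0: "(0, 0) \<in> K" using b R by (simp add: K_def mem_box_cart)
  moreover have "continuous_on K f"
    unfolding f_def
    by (intro continuous_intros continuous_on_compose2[OF u1(2)] continuous_on_compose2[OF u2(2)]) auto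
  ultimately obtain z where z: "z \<in> K" "\<forall>w\<in>K. f w \<le> f z"
    using continuous_attains_sup[of K f] by blast
  have "f (x, y) \<le> f z" for x y
  proof (cases "norm (x - y) \<le> R")
    case True
    obtain k where k: "k \<in> int_lattice" "x + k \<in> cbox 0 1" using lattice_shift_into_cube by blast
    have "norm (y + k) \<le> norm (x + k) + norm (x - y)"
      using norm_triangle_ineq4[of "x + k" "x - y"] by (simp add: add.commute)
    then have "(x + k, y + k) \<in> K" using k b(2)[OF k(2)] True by (simp add: K_def)
    then have "f (x + k, y + k) \<le> f z" using z by blast
    then show ?thesis using u1(1) u2(1) k(1) by (simp add: f_def torus_periodic_def)
  next
    case False
    then have "L * R < L * norm (x - y)" using L by simp
    then have "f (x, y) \<le> f (0, 0)"
      using M1(2)[of x] M1(2)[of 0] M2(2)[of y] M2(2)[of 0] R(2) by (simp add: f_def abs_le_iff)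
    also have "\<dots> \<le> f z" using z 0 by blast
    finally show ?thesis .
  qed
  then show ?thesis by (intro that[of "fst z" "snd z"]) (simp add: f_def)
qed

theorem lemma2p1:
  fixes \<sigma> A :: "real ^ 'n \<Rightarrow> real ^ 'n ^ 'n"
    and H :: "real ^ 'n \<Rightarrow> real ^ 'n \<Rightarrow> real"
    and \<phi> :: "real ^ 'n \<Rightarrow> real"
    and L \<epsilon> :: real
    and x\<epsilon> :: "real ^ 'n"
  assumes sigma: "W1inf_torus \<sigma>"
    and A: "\<And>x. A x = \<sigma> x ** transpose (\<sigma> x)"
    and H_periodic: "\<And>p. torus_periodic (\<lambda>x. H x p)"
    and H_cont: "continuous_on UNIV (\<lambda>(x, p). H x p)"
    and L: "L > 1"
    and H_growth: "\<And>x y p. norm p = L \<Longrightarrow>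
      H x p \<ge> norm p * (H y (p /\<^sub>R norm p) + (SUP z. \<bar>H z 0\<bar>)
                + real CARD('n) powr (3 / 2) * (best_lipschitz \<sigma>)\<^sup>2)"
    and eps: "\<epsilon> > 0"
    and phi_periodic: "torus_periodic \<phi>"
    and phi_cont: "continuous_on UNIV \<phi>"
    and phi_sol: "viscosity_solution (\<lambda>x r p X. \<epsilon> * r - trace (A x ** X) + H x p) \<phi>"
    and x_min: "\<And>y. \<phi> x\<epsilon> \<le> \<phi> y"
  shows "\<forall>x. \<phi> x - \<phi> x\<epsilon> \<le> L * torus_dist x x\<epsilon>"
proof -
  define m where "m = \<phi> x\<epsilon>"
  define N where "N = real CARD('n)"
  define C where "C = best_lipschitz \<sigma>"
  define h0 where "h0 = (SUP z. \<bar>H z 0\<bar>)"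
  have lip: "torus_lipschitz C \<sigma>" unfolding C_def by (rule best_lipschitz[OF sigma])
  have N: "1 \<le> N" by (simp add: N_def Suc_leI)
  have trace_A: "trace (A x ** X) = trace_along (\<lambda>i. column i (\<sigma> x)) X" for x X
    unfolding A by (rule trace_mult_transpose)
  have subsol: "\<epsilon> * \<phi> x + H x (D\<psi> x) \<le> trace_along (\<lambda>i. column i (\<sigma> x)) (D2\<psi> x)"
    if "C2_function \<psi> D\<psi> D2\<psi>" "\<forall>\<^sub>F y in nhds x. \<phi> y - \<psi> y \<le> \<phi> x - \<psi> x" for \<psi> D\<psi> D2\<psi> x
  proof -
    have "\<epsilon> * \<phi> x - trace (A x ** D2\<psi> x) + H x (D\<psi> x) \<le> 0"
      using phi_sol that unfolding viscosity_solution_def viscosity_subsolution_def by blast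
    then show ?thesis by (simp add: trace_A)
  qed
  have supersol: "trace_along (\<lambda>i. column i (\<sigma> x)) (D2\<psi> x) \<le> \<epsilon> * \<phi> x + H x (D\<psi> x)"
    if "C2_function \<psi> D\<psi> D2\<psi>" "\<forall>\<^sub>F y in nhds x. \<phi> x - \<psi> x \<le> \<phi> y - \<psi> y" for \<psi> D\<psi> D2\<psi> x
  proof -
    have "0 \<le> \<epsilon> * \<phi> x - trace (A x ** D2\<psi> x) + H x (D\<psi> x)"
      using phi_sol that unfolding viscosity_solution_def viscosity_supersolution_def by blast
    then show ?thesis by (simp add: trace_A)
  qed
  have H_comp: "continuous_on UNIV (\<lambda>z. H (f z) (g z))"
    if "continuous_on UNIV f" "continuous_on UNIV g" for f g :: "'z::topological_space \<Rightarrow> real ^ 'n"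
    using continuous_on_compose2[OF H_cont, of UNIV "\<lambda>z. (f z, g z)"] that
    by (simp add: continuous_on_Pair)
  have h0: "\<bar>H z 0\<bar> \<le> h0" for z
  proof -
    have "continuous_on UNIV (\<lambda>z. H z 0)" by (intro H_comp continuous_intros)
    from torus_periodic_bounded[OF H_periodic this]
    obtain b where "\<And>z. \<bar>H z 0\<bar> \<le> b" by auto
    then have "bdd_above (range (\<lambda>z. \<bar>H z 0\<bar>))" by (intro bdd_aboveI2)
    then show ?thesis unfolding h0_def by (rule cSUP_upper2) auto
  qed
  have \<epsilon>m: "\<epsilon> * m \<le> h0"
  proof -
    obtain z where z: "\<And>y. \<phi> y \<le> \<phi> z" using torus_periodic_max[OF phi_periodic phi_cont] by blast
    have "\<epsilon> * \<phi> z + H z 0 \<le> 0"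
      using subsol[OF C2_const[of 0], of z] z by simp
    moreover have "\<epsilon> * m \<le> \<epsilon> * \<phi> z"
      using x_min[of z] eps by (simp add: m_def)
    ultimately show ?thesis using h0[of z] by linarith
  qed
  have L0: "0 < L" using L by simp
  \<comment> \<open>the comparison on the whole space, by doubling the variables after a sup-convolution with parameter delta\<close>
  have key: "\<phi> x - L * \<phi> y + (L - 1) * m \<le> L * norm (x - y)" for x y
  proof (rule ccontr)
    assume "\<not> ?thesis"
    then obtain \<mu> where \<mu>: "0 < \<mu>" and \<mu>_eq: "\<mu> = \<phi> x - L * \<phi> y + (L - 1) * m - L * norm (x - y)"
      by simp
    obtain M where M: "M > 0" "\<And>x. \<bar>\<phi> x\<bar> \<le> M"
      using torus_periodic_bounded[OF phi_periodic phi_cont] by (metis real_norm_def)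
    define \<phi>2 where "\<phi>2 y = - L * \<phi> y" for y
    have \<phi>2_per: "torus_periodic \<phi>2" using phi_periodic by (simp add: \<phi>2_def torus_periodic_def)
    have \<phi>2_cont: "continuous_on UNIV \<phi>2" unfolding \<phi>2_def by (intro continuous_intros phi_cont)
    have "uniformly_continuous_on UNIV \<phi>"
      by (rule torus_periodic_uniformly_continuous[OF phi_periodic phi_cont])
    then obtain r where r: "0 < r" "\<And>x y. dist y x < r \<Longrightarrow> dist (\<phi> y) (\<phi> x) < \<mu>"
      unfolding uniformly_continuous_on_def using \<mu> by (metis UNIV_I)
    \<comment> \<open>the first bound keeps the maximizers within r / 4, the second one makes 2 * delta * L at most an eighth of r\<close>
    define \<delta> where "\<delta> = min (r\<^sup>2 / (64 * L * M)) (r / (16 * L))"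
    have \<delta>: "0 < \<delta>" using r(1) L0 M(1) by (simp add: \<delta>_def)
    have \<delta>1: "4 * (L * M) * \<delta> \<le> (r / 4)\<^sup>2"
    proof -
      have "4 * (L * M) * \<delta> \<le> 4 * (L * M) * (r\<^sup>2 / (64 * L * M))"
        using L0 M(1) by (intro mult_left_mono) (auto simp: \<delta>_def)
      also have "\<dots> = (r / 4)\<^sup>2" using L0 M(1) by (simp add: power_divide)
      finally show ?thesis .
    qed
    have \<delta>2: "16 * (\<delta> * L) \<le> r"
    proof -
      have "\<delta> * (16 * L) \<le> r / (16 * L) * (16 * L)"
        using L0 by (intro mult_right_mono) (auto simp: \<delta>_def)
      then show ?thesis using L0 by simp
    qed
    have bound1: "\<bar>\<phi> x\<bar> \<le> L * M" for x
    proof -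
      have "1 * M \<le> L * M" using L M(1) by (intro mult_right_mono) auto
      then show ?thesis using M(2)[of x] by linarith
    qed
    have bound2: "\<bar>\<phi>2 x\<bar> \<le> L * M" for x
      using mult_left_mono[OF M(2)[of x], of L] L0 by (simp add: \<phi>2_def abs_mult)
    interpret b1: sup_convolution \<phi> "L * M" \<delta>
      by unfold_locales (use phi_cont bound1 \<delta> in auto)
    interpret b2: sup_convolution \<phi>2 "L * M" \<delta>
      by unfold_locales (use \<phi>2_cont bound2 \<delta> in auto)
    obtain x0 y0 where max: "\<And>x y. sup_conv \<delta> \<phi> x + sup_conv \<delta> \<phi>2 y - L * norm (x - y)
        \<le> sup_conv \<delta> \<phi> x0 + sup_conv \<delta> \<phi>2 y0 - L * norm (x0 - y0)"
      using penalized_sum_max[OF b1.sup_conv_periodic[OF phi_periodic] b1.sup_conv_continuous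
          b2.sup_conv_periodic[OF \<phi>2_per] b2.sup_conv_continuous L0] by blast
    obtain \<xi>0 where \<xi>0: "sup_conv_point \<delta> \<phi> x0 \<xi>0" using b1.sup_conv_attained .
    obtain \<zeta>0 where \<zeta>0: "sup_conv_point \<delta> \<phi>2 y0 \<zeta>0" using b2.sup_conv_attained .
    define \<rho> where "\<rho> = norm (x0 - y0)"
    have gain: "\<mu> - (L - 1) * m + L * \<rho> \<le> \<phi> \<xi>0 - L * \<phi> \<zeta>0"
    proof -
      have "\<phi> x \<le> sup_conv \<delta> \<phi> x" "\<phi>2 y \<le> sup_conv \<delta> \<phi>2 y"
        using b1.sup_conv_ge[of x x] b2.sup_conv_ge[of y y] by auto
      moreover have "sup_conv \<delta> \<phi> x0 \<le> \<phi> \<xi>0" "sup_conv \<delta> \<phi>2 y0 \<le> \<phi>2 \<zeta>0"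
        using \<xi>0 \<zeta>0 \<delta> by (auto simp: sup_conv_point_def)
      ultimately show ?thesis
        using max[of x y] by (simp add: \<mu>_eq \<phi>2_def \<rho>_def)
    qed
    \<comment> \<open>for equal arguments the quantity maximized is (L - 1) (m - phi) and hence not positive\<close>
    have far: "r \<le> norm (\<xi>0 - \<zeta>0)"
    proof (rule ccontr)
      assume "\<not> r \<le> norm (\<xi>0 - \<zeta>0)"
      then have "\<phi> \<xi>0 - \<phi> \<zeta>0 < \<mu>"
        using r(2)[of \<xi>0 \<zeta>0] by (simp add: dist_norm)
      moreover have "(L - 1) * m \<le> (L - 1) * \<phi> \<zeta>0"
        using x_min[of \<zeta>0] L by (simp add: m_def)
      moreover have "0 \<le> L * \<rho>" using L0 by (simp add: \<rho>_def)
      ultimately show False using gain by (simp add: algebra_simps)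
    qed
    have "(norm (x0 - \<xi>0))\<^sup>2 \<le> (r / 4)\<^sup>2" "(norm (y0 - \<zeta>0))\<^sup>2 \<le> (r / 4)\<^sup>2"
      using b1.sup_conv_point_dist[OF \<xi>0] b2.sup_conv_point_dist[OF \<zeta>0] \<delta>1 by linarith+
    then have near: "norm (x0 - \<xi>0) \<le> r / 4" "norm (y0 - \<zeta>0) \<le> r / 4"
      using r(1) by (auto intro: power2_le_imp_le)
    have "norm (\<xi>0 - \<zeta>0) \<le> norm (x0 - \<xi>0) + \<rho> + norm (y0 - \<zeta>0)"
      using norm_triangle_ineq[of "\<xi>0 - x0" "(x0 - y0) + (y0 - \<zeta>0)"] norm_triangle_ineq[of "x0 - y0" "y0 - \<zeta>0"]
      by (simp add: \<rho>_def norm_minus_commute)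
    then have \<rho>r: "r / 2 \<le> \<rho>" using far near by linarith
    then have \<rho>: "0 < \<rho>" using r(1) by simp
    have \<rho>_le: "\<rho> \<le> sqrt N / 2"
    proof -
      obtain k where k: "k \<in> int_lattice" "norm (x0 - y0 - k) \<le> sqrt N / 2"
        using lattice_point_near[of "x0 - y0"] by (auto simp: N_def)
      have "sup_conv \<delta> \<phi>2 (y0 + k) = sup_conv \<delta> \<phi>2 y0"
        using b2.sup_conv_periodic[OF \<phi>2_per] k(1) by (simp add: torus_periodic_def)
      then have "L * \<rho> \<le> L * norm (x0 - y0 - k)"
        using max[of x0 "y0 + k"] by (simp add: \<rho>_def algebra_simps)
      then show ?thesis using L0 k(2) by simp
    qed
    \<comment> \<open>the paraboloid B * s^2 touches the cone L * s from above at s = rho, up to a constant\<close>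
    define B where "B = L / (2 * \<rho>)"
    have B: "0 \<le> B" "2 * B * \<rho> = L" using L0 \<rho> by (auto simp: B_def)
    have quad: "sup_conv \<delta> \<phi> x + sup_conv \<delta> \<phi>2 y
        \<le> sup_conv \<delta> \<phi> x0 + sup_conv \<delta> \<phi>2 y0 + B * ((norm (x - y))\<^sup>2 - (norm (x0 - y0))\<^sup>2)" for x y
    proof -
      have "B * ((norm (x - y))\<^sup>2 - \<rho>\<^sup>2) - (2 * B * \<rho>) * (norm (x - y) - \<rho>) = B * (norm (x - y) - \<rho>)\<^sup>2"
        by (simp add: power2_eq_square algebra_simps)
      moreover have "0 \<le> B * (norm (x - y) - \<rho>)\<^sup>2" using B(1) by simp
      ultimately have "L * (norm (x - y) - \<rho>) \<le> B * ((norm (x - y))\<^sup>2 - \<rho>\<^sup>2)"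
        unfolding B(2) by linarith
      then show ?thesis using max[of x y] by (simp add: \<rho>_def algebra_simps)
    qed
    define p where "p = (2 * B) *\<^sub>R (x0 - y0)"
    have p: "norm p = L" using B by (simp add: p_def \<rho>_def)
    define F1 where "F1 x p = \<epsilon> * \<phi> x + H x p" for x p
    \<comment> \<open>- L * phi is a subsolution because phi is a supersolution; the factor 1 / L rescales its gradient\<close>
    define F2 where "F2 x p = - L * (\<epsilon> * \<phi> x + H x (- (1 / L) *\<^sub>R p))" for x p
    have F1: "continuous_on UNIV (\<lambda>(x, p). F1 x p)"
      unfolding F1_def case_prod_beta
      by (intro continuous_intros H_comp continuous_on_compose2[OF phi_cont]) auto
    have F2: "continuous_on UNIV (\<lambda>(x, p). F2 x p)"
      unfolding F2_def case_prod_beta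
      by (intro continuous_intros H_comp continuous_on_compose2[OF phi_cont]) auto
    have sub1: "viscosity_subsolution (\<lambda>x _ p X. F1 x p - trace_along (\<lambda>i. column i (\<sigma> x)) X) \<phi>"
      unfolding viscosity_subsolution_def F1_def using subsol by fastforce
    have sub2: "viscosity_subsolution (\<lambda>x _ p X. F2 x p - trace_along (\<lambda>i. column i (\<sigma> x)) X) \<phi>2"
      unfolding viscosity_subsolution_def
    proof (intro allI impI)
      fix \<psi> D\<psi> D2\<psi> x
      assume \<psi>: "C2_function \<psi> D\<psi> D2\<psi>" and touch: "\<forall>\<^sub>F y in nhds x. \<phi>2 y - \<psi> y \<le> \<phi>2 x - \<psi> x"
      have "\<forall>\<^sub>F y in nhds x. \<phi> x - (- (1 / L)) * \<psi> x \<le> \<phi> y - (- (1 / L)) * \<psi> y"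
        using touch
      proof eventually_elim
        case (elim y)
        then have "(L * \<phi> x + \<psi> x) / L \<le> (L * \<phi> y + \<psi> y) / L"
          using L0 by (intro divide_right_mono) (auto simp: \<phi>2_def)
        then show ?case using L0 by (simp add: add_divide_distrib)
      qed
      from supersol[OF C2_cmult[OF \<psi>] this]
      have "- (1 / L) * trace_along (\<lambda>i. column i (\<sigma> x)) (D2\<psi> x) \<le> \<epsilon> * \<phi> x + H x (- (1 / L) *\<^sub>R D\<psi> x)"
        unfolding scaleR_matrix_mult_vec inner_scaleR_left sum_distrib_left .
      from mult_left_mono[OF this, of L]
      show "F2 x (D\<psi> x) - trace_along (\<lambda>i. column i (\<sigma> x)) (D2\<psi> x) \<le> 0"
        using L0 by (simp add: F2_def)
    qed
    define S where "S = (\<Sum>i\<in>UNIV. (norm (column i (\<sigma> \<xi>0) - column i (\<sigma> \<zeta>0)))\<^sup>2)"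
    note dbl = doubling_inequality[OF b1.sup_convolution_axioms b2.sup_convolution_axioms phi_periodic \<phi>2_per
        torus_lipschitz_continuous[OF lip] F1 F2 sub1 sub2 \<xi>0 \<zeta>0 B(1) quad p_def]
    have ineq: "\<epsilon> * (\<phi> \<xi>0 - L * \<phi> \<zeta>0) + H \<xi>0 p - L * H \<zeta>0 ((1 / L) *\<^sub>R p) \<le> 2 * B * S"
      using dbl(1) by (simp add: F1_def F2_def S_def algebra_simps)
    have "\<xi>0 - \<zeta>0 = (x0 - y0) + (2 * \<delta>) *\<^sub>R p"
      unfolding dbl(2,3) by (simp add: algebra_simps scaleR_2[symmetric])
    then have "norm (\<xi>0 - \<zeta>0) \<le> \<rho> + 2 * \<delta> * L"
      using norm_triangle_ineq[of "x0 - y0" "(2 * \<delta>) *\<^sub>R p"] \<delta> by (simp add: \<rho>_def p)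
    also have "\<dots> \<le> 5 / 4 * \<rho>" using \<delta>2 \<rho>r by simp
    finally have "(norm (\<xi>0 - \<zeta>0))\<^sup>2 \<le> (5 / 4 * \<rho>)\<^sup>2"
      by (intro power_mono) auto
    also have "\<dots> = (25 / 16 * \<rho>) * \<rho>" by (simp add: power2_eq_square)
    also have "\<dots> \<le> sqrt N * \<rho>" using \<rho> \<rho>_le by (intro mult_right_mono) auto
    finally have "N * C\<^sup>2 * (norm (\<xi>0 - \<zeta>0))\<^sup>2 \<le> N * C\<^sup>2 * (sqrt N * \<rho>)"
      using N by (intro mult_left_mono) auto
    then have "S \<le> N * C\<^sup>2 * (sqrt N * \<rho>)"
      using torus_lipschitz_columns[OF lip, of \<xi>0 \<zeta>0] unfolding S_def[symmetric] N_def[symmetric] by linarith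
    then have "2 * B * S \<le> 2 * B * (N * C\<^sup>2 * (sqrt N * \<rho>))"
      using B(1) by (intro mult_left_mono) auto
    also have "\<dots> = (2 * B * \<rho>) * (N * sqrt N * C\<^sup>2)" by (simp add: mult_ac)
    also have "\<dots> = L * (N powr (3 / 2) * C\<^sup>2)"
    proof -
      have "N powr (3 / 2) = N powr 1 * N powr (1 / 2)"
        by (simp only: powr_add[symmetric]) simp
      then show ?thesis using N by (simp add: B(2) powr_half_sqrt)
    qed
    finally have BS: "2 * B * S \<le> L * (N powr (3 / 2) * C\<^sup>2)" .
    have growth: "L * (H \<zeta>0 ((1 / L) *\<^sub>R p) + h0 + N powr (3 / 2) * C\<^sup>2) \<le> H \<xi>0 p"
      using H_growth[OF p, of \<zeta>0 \<xi>0] 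
      unfolding p h0_def[symmetric] N_def[symmetric] C_def[symmetric] inverse_eq_divide .
    have "\<epsilon> * (\<mu> - (L - 1) * m + L * \<rho>) \<le> \<epsilon> * (\<phi> \<xi>0 - L * \<phi> \<zeta>0)"
      using gain eps by (intro mult_left_mono) auto
    then have "\<epsilon> * \<mu> + \<epsilon> * (L * \<rho>) + L * h0 \<le> (L - 1) * (\<epsilon> * m)"
      using ineq BS growth by (simp add: algebra_simps)
    also have "\<dots> \<le> (L - 1) * h0" using \<epsilon>m L by (intro mult_left_mono) auto
    finally have "\<epsilon> * \<mu> + \<epsilon> * (L * \<rho>) + h0 \<le> 0" by (simp add: algebra_simps)
    moreover have "0 < \<epsilon> * \<mu>" "0 < \<epsilon> * (L * \<rho>)" "0 \<le> h0"
      using eps \<mu> L0 \<rho> h0[of 0] by auto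
    ultimately show False by linarith
  qed
  show ?thesis
  proof
    fix x
    have "(\<phi> x - \<phi> x\<epsilon>) / L \<le> norm (x - x\<epsilon> + k)" if "k \<in> int_lattice" for k
    proof -
      have "\<phi> (x\<epsilon> + - k) = m"
        using phi_periodic int_lattice_zero_neg(2)[OF that] unfolding torus_periodic_def m_def by blast
      then have "\<phi> x - m \<le> L * norm (x - x\<epsilon> + k)"
        using key[of x "x\<epsilon> + - k"] by (simp add: algebra_simps)
      then show ?thesis using L0 by (simp add: m_def pos_divide_le_eq mult.commute)
    qed
    then have "(\<phi> x - \<phi> x\<epsilon>) / L \<le> torus_dist x x\<epsilon>"
      unfolding torus_dist_def using int_lattice_zero_neg(1) by (intro cINF_greatest) auto
    then show "\<phi> x - \<phi> x\<epsilon> \<le> L * torus_dist x x\<epsilon>"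
      using L0 by (simp add: pos_divide_le_eq mult.commute)
  qed
qed

end
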